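(* Let $H$ be a Hilbert space, $\Omega\subseteq H$ a nonempty open set, $F:\Omega\to H$ an analytic function, $T:H\rightrightarrows H$ a set-valued maximal monotone operator and $x^*\in\Omega$. Suppose that $0\in F(x^* )+T(x^* )$, that $F'(x^* )$ is a positive operator and that $\widehat{F'(x^* )}^{-1}$ exists. Suppose that $$\gamma:=\|\widehat{F'(x^* )}^{-1}\|\,\sup_{n>1}\left\|\frac{F^{(n)}(x^* )}{n!}\right\|^{1/(n-1)}<+\infty .$$ Let $r=\min\{\kappa,(5-\sqrt{17})/(4\gamma)\}$, where $\kappa:=\sup\{t>0: B(x^*,t)\subset\Omega\}$. Then the sequences with starting point $x_0\in B(x^*,r)\setminus\{x^*\}$ and $t_0=\|x^*-x_0\|$, given respectively by $$0\in F(x_k)+F'(x_k)(x_{k+1}-x_k)+T(x_{k+1}),\qquad t_{k+1}=\frac{\gamma t_k^2}{2(1-\gamma t_k)^2-1},\qquad k=0,1,\ldots,$$ are well defined; $\{t_k\}$ is strictly decreasing, contained in $(0,r)$ and converges to $0$; $\{x_k\}$ is contained in $B(x^*,r)$ and converges to the point $x^*$, which is the unique solution of $F(x)+T(x)\ni0$ in $B(x^*,\bar\sigma)$, where $\bar\sigma=\min\{r,1/(2\gamma)\}$. Moreover, $\{t_{k+1}/t_k^2\}$ is strictly decreasing, $$\frac{t_{k+1}}{t_k^2}<\frac{\gamma}{2(1-\gamma\|x_0-x^*\|)^2-1},\qquad k=0,1,\ldots,$$ and $$\|x_{k+1}-x^*\|\le\frac{\gamma}{2(1-\gamma t_k)^2-1}\|x_k-x^*\|^2\le\frac{\gamma}{2(1-\gamma\|x_0-x^*\|)^2-1}\|x_k-x^*\|^2,\qquad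 k=0,1,\ldots.$$ If, additionally, $(5-\sqrt{17})/(4\gamma)<\kappa$, then $r=(5-\sqrt{17})/(4\gamma)$ is the best possible convergence radius.
   Context: $B(x,\delta)$ denotes the open ball with centre $x$ and radius $\delta$; $F'$ is the Fréchet derivative of $F$ and $F^{(n)}(x^* )$ is its $n$-th Fréchet derivative at $x^*$, with the usual norm of $n$-linear maps. A bounded linear operator $G:H\to H$ is called positive if it is self-conjugate (self-adjoint) and $\langle Gx,x\rangle\ge 0$ for all $x\in H$. For a bounded linear operator $G:H\to H$ with conjugate (adjoint) operator $G^*$, $\widehat G:=\frac12(G+G^* )$; norms of operators are operator norms. A set-valued operator $T:H\rightrightarrows H$ with $\mathrm{dom}\,T=\{x\in H: T(x)\ne\varnothing\}$ is monotone if $\langle u-v,y-x\rangle\ge 0$ whenever $x,y\in\mathrm{dom}\,T$, $u\in T(y)$ and $v\in T(x)$; it is maximal monotone if it is monotone and, whenever $x,u\in H$ satisfy $\langle u-v,x-y\rangle\ge0$ for all $y\in\mathrm{dom}\,T$ and $v\in T(y)$, then $x\in\mathrm{dom}\,T$ and $u\in T(x)$. The sequence $\{x_k\}$ is the Newton sequence for the generalized equation $F(x)+T(x)\ni0$.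
   Formalization: If β=‖F̂'(x* )⁻¹‖<1, γ is sup(β‖F⁽ⁿ⁾(x* )/n!‖)^{1/(n-1)} (printed γ fails); the strict quotient bound is for k≥1, with ≤ at k=0; strict decrease, t_k>0 and quotient claims assume γ≠0; "best possible" is over all problems in H with the same γ. *)

theory Defs
  imports "HOL-Analysis.Analysis"
begin

section \<open>Multilinear maps and higher Frechet derivatives\<close>

text \<open>
  An \<open>n\<close>-linear map is a function on argument lists of length \<open>n\<close>; its values on lists of
  other lengths are irrelevant.
\<close>

definition bounded_multilinear ::
    "nat \<Rightarrow> ('a::real_normed_vector list \<Rightarrow> 'b::real_normed_vector) \<Rightarrow> bool" where
  "bounded_multilinear n A \<longleftrightarrow>
     (\<forall>vs i. length vs = n \<longrightarrow> i < n \<longrightarrow> linear (\<lambda>v. A (vs[i := v]))) \<and>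
     (\<exists>K. \<forall>vs. length vs = n \<longrightarrow> norm (A vs) \<le> K * prod_list (map norm vs))"

definition multilinear_norm ::
    "nat \<Rightarrow> ('a::real_normed_vector list \<Rightarrow> 'b::real_normed_vector) \<Rightarrow> real" where
  "multilinear_norm n A = (SUP vs \<in> {vs. length vs = n \<and> (\<forall>v\<in>set vs. norm v \<le> 1)}. norm (A vs))"

text \<open>
  \<open>nth_frechet n F x [v\<^sub>1, \<dots>, v\<^sub>n]\<close> is the \<open>n\<close>-th derivative of \<open>F\<close> at \<open>x\<close> applied to
  \<open>v\<^sub>1, \<dots>, v\<^sub>n\<close>. The recursion only computes its value, argument by argument; that the derivatives
  exist in the Frechet sense, that is, in the norm of \<open>n\<close>-linear maps, is the content of
  \<open>smooth_map_on\<close>.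
\<close>

primrec nth_frechet ::
    "nat \<Rightarrow> ('a::real_normed_vector \<Rightarrow> 'b::real_normed_vector) \<Rightarrow> 'a \<Rightarrow> 'a list \<Rightarrow> 'b" where
  "nth_frechet 0 F x vs = F x"
| "nth_frechet (Suc n) F x vs = frechet_derivative (\<lambda>y. nth_frechet n F y (tl vs)) (at x) (hd vs)"

definition smooth_map_on ::
    "('a::real_normed_vector \<Rightarrow> 'b::real_normed_vector) \<Rightarrow> 'a set \<Rightarrow> bool" where
  "smooth_map_on F S \<longleftrightarrow> (\<forall>n. \<forall>x\<in>S.
     bounded_multilinear n (nth_frechet n F x) \<and>
     ((\<lambda>h. multilinear_norm n (\<lambda>vs. nth_frechet n F (x + h) vs - nth_frechet n F x vs
                                    - nth_frechet (Suc n) F x (h # vs)) / norm h) \<longlongrightarrow> 0) (at 0))"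

definition analytic_map_on ::
    "('a::real_normed_vector \<Rightarrow> 'b::real_normed_vector) \<Rightarrow> 'a set \<Rightarrow> bool" where
  "analytic_map_on F S \<longleftrightarrow> smooth_map_on F S \<and>
     (\<forall>a\<in>S. \<exists>e>0. \<forall>x\<in>ball a e.
        (\<lambda>n. nth_frechet n F a (replicate n (x - a)) /\<^sub>R fact n) sums F x)"

section \<open>Operators on a Hilbert space\<close>

definition positive_operator :: "('a::real_inner \<Rightarrow> 'a) \<Rightarrow> bool" where
  "positive_operator G \<longleftrightarrow> bounded_linear G \<and> (\<forall>x y. G x \<bullet> y = x \<bullet> G y) \<and> (\<forall>x. 0 \<le> G x \<bullet> x)"

definition sym_part :: "('a::real_inner \<Rightarrow> 'a) \<Rightarrow> 'a \<Rightarrow> 'a" where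
  "sym_part G = (\<lambda>x. (1/2) *\<^sub>R (G x + adjoint G x))"

definition invertible_operator :: "('a::real_normed_vector \<Rightarrow> 'a) \<Rightarrow> bool" where
  "invertible_operator G \<longleftrightarrow> bounded_linear G \<and> bij G \<and> bounded_linear (inv G)"

definition operator_domain :: "('a \<Rightarrow> 'b set) \<Rightarrow> 'a set" where
  "operator_domain T = {x. T x \<noteq> {}}"

definition monotone_operator :: "('a::real_inner \<Rightarrow> 'a set) \<Rightarrow> bool" where
  "monotone_operator T \<longleftrightarrow>
     (\<forall>x\<in>operator_domain T. \<forall>y\<in>operator_domain T. \<forall>u\<in>T y. \<forall>v\<in>T x. 0 \<le> (u - v) \<bullet> (y - x))"

definition maximal_monotone_operator :: "('a::real_inner \<Rightarrow> 'a set) \<Rightarrow> bool" where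
  "maximal_monotone_operator T \<longleftrightarrow> monotone_operator T \<and>
     (\<forall>x u. (\<forall>y\<in>operator_domain T. \<forall>v\<in>T y. 0 \<le> (u - v) \<bullet> (x - y))
            \<longrightarrow> x \<in> operator_domain T \<and> u \<in> T x)"

section \<open>Newton's method for \<open>0 \<in> F x + T x\<close>\<close>

definition newton_step ::
    "('a::real_normed_vector \<Rightarrow> 'a) \<Rightarrow> ('a \<Rightarrow> 'a set) \<Rightarrow> 'a \<Rightarrow> 'a \<Rightarrow> bool" where
  "newton_step F T x y \<longleftrightarrow> 0 \<in> (F x + frechet_derivative F (at x) (y - x)) +o T y"

text \<open>The iterates have to stay in \<open>\<Omega>\<close>, because the values of \<open>F\<close> outside \<open>\<Omega>\<close> have no meaning.\<close>

definition newton_sequence ::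
    "'a::real_normed_vector set \<Rightarrow> ('a \<Rightarrow> 'a) \<Rightarrow> ('a \<Rightarrow> 'a set) \<Rightarrow> 'a \<Rightarrow> (nat \<Rightarrow> 'a) \<Rightarrow> bool" where
  "newton_sequence \<Omega> F T x0 x \<longleftrightarrow>
     x 0 = x0 \<and> (\<forall>k. x k \<in> \<Omega> \<and> newton_step F T (x k) (x (Suc k)))"

primrec scalar_sequence :: "real \<Rightarrow> real \<Rightarrow> nat \<Rightarrow> real" where
  "scalar_sequence \<gamma> t0 0 = t0"
| "scalar_sequence \<gamma> t0 (Suc k) =
     \<gamma> * (scalar_sequence \<gamma> t0 k)\<^sup>2 / (2 * (1 - \<gamma> * scalar_sequence \<gamma> t0 k)\<^sup>2 - 1)"

text \<open>
  Let \<open>\<beta>\<close> be the norm of the inverse of the symmetric part of \<open>F'(x)\<close>. The first branch is the usual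
  product \<open>\<beta> * sup\<close>. The convergence theory rests on
  \<open>\<beta> * \<parallel>F\<^sup>(\<^sup>n\<^sup>)(x) / n!\<parallel> \<le> \<gamma> ^ (n - 1)\<close> for \<open>n > 1\<close>. The product guarantees this only for
  \<open>\<beta> \<ge> 1\<close>. For \<open>\<beta> < 1\<close> the factor \<open>\<beta>\<close> has to stay under the root: with the product, the real function
  \<open>F x = 8 * x - x\<^sup>2 / (1 - x)\<close> on \<open>{-1<..<1}\<close>, with \<open>T x = {0}\<close> and solution \<open>0\<close>, would get
  \<open>\<gamma> = 1/8\<close> and the convergence radius \<open>1\<close>, although \<open>F' (2/3) = 0\<close> and \<open>F (2/3) = 4\<close>.
\<close>

definition newton_gamma :: "('a::real_inner \<Rightarrow> 'a) \<Rightarrow> 'a \<Rightarrow> ereal" where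
  "newton_gamma F x =
    (let \<beta> = onorm (inv (sym_part (frechet_derivative F (at x))));
         a = (\<lambda>n. multilinear_norm n (\<lambda>vs. nth_frechet n F x vs /\<^sub>R fact n))
     in if 1 \<le> \<beta> then ereal \<beta> * (SUP n\<in>{2..}. ereal (root (n - 1) (a n)))
        else (SUP n\<in>{2..}. ereal (root (n - 1) (\<beta> * a n))))"

definition newton_problem ::
    "'a::{real_inner, banach} set \<Rightarrow> ('a \<Rightarrow> 'a) \<Rightarrow> ('a \<Rightarrow> 'a set) \<Rightarrow> 'a \<Rightarrow> real \<Rightarrow> bool" where
  "newton_problem \<Omega> F T xstar \<gamma> \<longleftrightarrow>
     open \<Omega> \<and> analytic_map_on F \<Omega> \<and> maximal_monotone_operator T \<and>
     xstar \<in> \<Omega> \<and> 0 \<in> F xstar +o T xstar \<and>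
     positive_operator (frechet_derivative F (at xstar)) \<and>
     invertible_operator (sym_part (frechet_derivative F (at xstar))) \<and>
     newton_gamma F xstar = ereal \<gamma>"

text \<open>
  \<open>R\<close> is a convergence radius for \<open>\<gamma>\<close> if, in every problem in \<open>H\<close> with this \<open>\<gamma>\<close> whose domain contains the
  ball of radius \<open>R\<close> about the solution, the method converges from every point of that ball.
\<close>

definition convergence_radius :: "'a::{real_inner, banach} itself \<Rightarrow> real \<Rightarrow> ereal \<Rightarrow> bool" where
  "convergence_radius H \<gamma> R \<longleftrightarrow>
     (\<forall>\<Omega> F T (xstar :: 'a). newton_problem \<Omega> F T xstar \<gamma> \<and> eball xstar R \<subseteq> \<Omega> \<longrightarrow>
        (\<forall>x0 \<in> eball xstar R - {xstar}. \<exists>x. newton_sequence \<Omega> F T x0 x \<and> x \<longlonglongrightarrow> xstar))"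

definition best_convergence_radius :: "'a::{real_inner, banach} itself \<Rightarrow> real \<Rightarrow> ereal \<Rightarrow> bool" where
  "best_convergence_radius H \<gamma> R \<longleftrightarrow>
     convergence_radius H \<gamma> R \<and> (\<forall>R'>R. \<not> convergence_radius H \<gamma> R')"

end

theory Submission
  imports Defs "HOL-Complex_Analysis.Complex_Analysis"
begin

text \<open>
  Let \<open>\<beta>\<close> be the norm of the inverse of \<open>F'(x*)\<close>, which is self-adjoint, so that
  \<open>\<parallel>v\<parallel>\<^sup>2 \<le> \<beta> * \<langle>F'(x*) v, v\<rangle>\<close>, and put \<open>u = \<gamma> * \<parallel>x - x*\<parallel>\<close>. By the identity theorem, \<open>F\<close> is the
  sum of its Taylor series at \<open>x*\<close> as long as \<open>u < 1\<close>. Comparison with geometric series bounds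
  \<open>\<beta> * \<parallel>F'(x) - F'(x*)\<parallel>\<close> by \<open>1 / (1 - u)\<^sup>2 - 1\<close> and the residual
  \<open>\<beta> * \<parallel>F'(x) (x - x*) - F x + F x*\<parallel>\<close> by \<open>\<gamma> * \<parallel>x - x*\<parallel>\<^sup>2 / (1 - u)\<^sup>2\<close>. The first bound makes
  \<open>F'(x)\<close> strongly monotone, so the Newton step exists by Minty's theorem; testing the monotonicity of
  \<open>T\<close> at the new iterate and at \<open>x*\<close> turns the second one into
  \<open>\<parallel>y - x*\<parallel> \<le> \<gamma> * \<parallel>x - x*\<parallel>\<^sup>2 / (2 * (1 - u)\<^sup>2 - 1)\<close>. This is a contraction towards \<open>x*\<close> iff
  \<open>2 * u\<^sup>2 - 5 * u + 1 > 0\<close>, whence the constant \<open>(5 - sqrt 17) / 4\<close>.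

  For the optimality let \<open>T = {0}\<close> and let \<open>e\<close> be a unit vector. Newton's method for
  \<open>x - \<gamma> * s\<^sup>2 / (1 - \<gamma> * s) * e\<close>, \<open>s = \<langle>x, e\<rangle>\<close>, on a ball slightly larger than allowed leaves the ball
  after one step; on balls of radius greater than \<open>1 / (2 * \<gamma>)\<close> the map \<open>x - \<gamma> * s\<^sup>2 * e\<close> has a
  point without Newton step.
\<close>

section \<open>Bounded multilinear maps\<close>

lemma bounded_multilinearD:
  assumes "bounded_multilinear n A" "length ps + Suc (length qs) = n"
  shows "linear (\<lambda>v. A (ps @ v # qs))"
proof -
  have "linear (\<lambda>v. A ((ps @ 0 # qs)[length ps := v]))"
    using assms unfolding bounded_multilinear_def by (metis add_Suc_right length_Cons length_append less_add_Suc1)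
  then show ?thesis by simp
qed

text \<open>The prefix \<open>ps\<close> collects the arguments whose scalars have already been
  pulled out; the induction needs it. The scalar may depend on the argument, so that all arguments
  can be normalized at once.\<close>

lemma multilinear_scale:
  assumes A: "bounded_multilinear n A"
  shows "length ps + length vs = n \<Longrightarrow>
    A (ps @ map (\<lambda>v. c v *\<^sub>R v) vs) = prod_list (map c vs) *\<^sub>R A (ps @ vs)"
proof (induction vs arbitrary: ps)
  case Nil
  then show ?case by simp
next
  case (Cons v vs)
  have "A (ps @ map (\<lambda>v. c v *\<^sub>R v) (v # vs)) = c v *\<^sub>R A (ps @ v # map (\<lambda>v. c v *\<^sub>R v) vs)"
    using linear_scale[OF bounded_multilinearD[OF A, of ps "map (\<lambda>v. c v *\<^sub>R v) vs"]] Cons.prems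
    by simp
  also have "A (ps @ v # map (\<lambda>v. c v *\<^sub>R v) vs) = prod_list (map c vs) *\<^sub>R A (ps @ v # vs)"
    using Cons.IH[of "ps @ [v]"] Cons.prems by simp
  finally show ?case by simp
qed

lemma multilinear_scale_replicate:
  assumes "bounded_multilinear n A"
  shows "A (replicate n (c *\<^sub>R v)) = c ^ n *\<^sub>R A (replicate n v)"
  using multilinear_scale[OF assms, of "[]" "replicate n v" "\<lambda>_. c"]
  by (simp add: prod_list_replicate)

lemma multilinear_zero:
  assumes A: "bounded_multilinear n A" and "length vs = n" "0 \<in> set vs"
  shows "A vs = 0"
proof -
  obtain ps qs where "vs = ps @ 0 # qs" using assms(3) by (meson split_list)
  then show ?thesis
    using linear_0[OF bounded_multilinearD[OF A, of ps qs]] assms(2) by simp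
qed

lemma prod_list_le_one:
  fixes f :: "'a \<Rightarrow> real"
  shows "(\<And>v. v \<in> set vs \<Longrightarrow> 0 \<le> f v \<and> f v \<le> 1) \<Longrightarrow> 0 \<le> prod_list (map f vs) \<and> prod_list (map f vs) \<le> 1"
  by (induction vs) (auto intro: mult_le_one)

lemma multilinear_norm_bdd:
  assumes "bounded_multilinear n A"
  shows "bdd_above ((\<lambda>vs. norm (A vs)) ` {vs. length vs = n \<and> (\<forall>v\<in>set vs. norm v \<le> 1)})"
proof -
  obtain K where K: "\<And>vs. length vs = n \<Longrightarrow> norm (A vs) \<le> K * prod_list (map norm vs)"
    using assms unfolding bounded_multilinear_def by blast
  have "norm (A vs) \<le> \<bar>K\<bar>" if "length vs = n" "\<forall>v\<in>set vs. norm v \<le> 1" for vs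
  proof -
    have p: "0 \<le> prod_list (map norm vs) \<and> prod_list (map norm vs) \<le> 1"
      using that by (intro prod_list_le_one) auto
    have "norm (A vs) \<le> K * prod_list (map norm vs)" using K that by blast
    also have "\<dots> \<le> \<bar>K\<bar> * 1" using p by (intro mult_mono) auto
    finally show ?thesis by simp
  qed
  then show ?thesis unfolding bdd_above_def by (intro exI[of _ "\<bar>K\<bar>"]) auto
qed

lemma multilinear_norm_nonneg:
  assumes "bounded_multilinear n A"
  shows "0 \<le> multilinear_norm n A"
proof -
  have "norm (A (replicate n 0)) \<le> multilinear_norm n A"
    unfolding multilinear_norm_def
    by (rule cSUP_upper[OF _ multilinear_norm_bdd[OF assms]]) (auto simp: set_replicate_conv_if)
  then show ?thesis using norm_ge_zero order_trans by blast
qed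

text \<open>Multilinearity reduces the claim to arguments of norm one, where the supremum bounds the
  value. A zero argument cannot be normalized, but it makes the value vanish.\<close>

lemma multilinear_norm_bound:
  assumes A: "bounded_multilinear n A" and len: "length vs = n"
  shows "norm (A vs) \<le> multilinear_norm n A * prod_list (map norm vs)"
proof (cases "0 \<in> set vs")
  case True
  have "0 \<le> prod_list (map norm vs)" by (rule prod_list_nonneg) auto
  then show ?thesis
    using multilinear_zero[OF A len True] multilinear_norm_nonneg[OF A] by simp
next
  case False
  define us where "us = map (\<lambda>v. inverse (norm v) *\<^sub>R v) vs"
  have "prod_list (map (inverse \<circ> norm) vs) * prod_list (map norm vs) = 1"
    using False by (induction vs) (auto simp: field_simps)
  then have inv: "prod_list (map (\<lambda>v. inverse (norm v)) vs) * prod_list (map norm vs) = 1"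
    by (simp add: comp_def)
  have p0: "0 \<le> prod_list (map norm vs)" by (rule prod_list_nonneg) auto
  have p1: "0 \<le> prod_list (map (\<lambda>v. inverse (norm v)) vs)" by (rule prod_list_nonneg) auto
  have "norm (A us) \<le> multilinear_norm n A"
    unfolding multilinear_norm_def
    by (rule cSUP_upper[OF _ multilinear_norm_bdd[OF A]]) (use len False in \<open>auto simp: us_def intro!: left_inverse[THEN eq_refl]\<close>)
  moreover have "A us = prod_list (map (\<lambda>v. inverse (norm v)) vs) *\<^sub>R A vs"
    using multilinear_scale[OF A, of "[]" vs "\<lambda>v. inverse (norm v)"] len by (simp add: us_def)
  ultimately have "prod_list (map (\<lambda>v. inverse (norm v)) vs) * norm (A vs) \<le> multilinear_norm n A"
    using p1 by simp
  then have "prod_list (map norm vs) * (prod_list (map (\<lambda>v. inverse (norm v)) vs) * norm (A vs))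
      \<le> prod_list (map norm vs) * multilinear_norm n A"
    using p0 by (rule mult_left_mono)
  moreover have "prod_list (map norm vs) * (prod_list (map (\<lambda>v. inverse (norm v)) vs) * norm (A vs)) = norm (A vs)"
    using inv by (metis mult.assoc mult.commute mult_1)
  ultimately show ?thesis by (metis mult.commute)
qed

lemma multilinear_norm_leI:
  assumes "\<And>vs. length vs = n \<Longrightarrow> \<forall>v\<in>set vs. norm v \<le> 1 \<Longrightarrow> norm (A vs) \<le> c"
  shows "multilinear_norm n A \<le> c"
  unfolding multilinear_norm_def
proof (rule cSUP_least)
  have "replicate n 0 \<in> {vs. length vs = n \<and> (\<forall>v\<in>set vs. norm v \<le> 1)}"
    by (auto simp: set_replicate_conv_if)
  then show "{vs. length vs = n \<and> (\<forall>v\<in>set vs. norm v \<le> 1)} \<noteq> {}" by blast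
qed (use assms in auto)

lemma bounded_multilinear_scaleR:
  assumes "bounded_multilinear n A"
  shows "bounded_multilinear n (\<lambda>vs. c *\<^sub>R A vs)"
proof -
  obtain K where K: "\<And>vs. length vs = n \<Longrightarrow> norm (A vs) \<le> K * prod_list (map norm vs)"
    using assms unfolding bounded_multilinear_def by blast
  have "norm (c *\<^sub>R A vs) \<le> (\<bar>c\<bar> * K) * prod_list (map norm vs)" if "length vs = n" for vs
    using mult_left_mono[OF K[OF that], of "\<bar>c\<bar>"] by (simp add: mult.assoc)
  moreover have "linear (\<lambda>v. c *\<^sub>R A (vs[i := v]))" if "length vs = n" "i < n" for vs i
    using assms that unfolding bounded_multilinear_def by (intro linear_compose_scale_right) auto
  ultimately show ?thesis unfolding bounded_multilinear_def by blast
qed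

lemma bounded_multilinear_diff:
  assumes "bounded_multilinear n A" "bounded_multilinear n B"
  shows "bounded_multilinear n (\<lambda>vs. A vs - B vs)"
proof -
  obtain K where K: "\<And>vs. length vs = n \<Longrightarrow> norm (A vs) \<le> K * prod_list (map norm vs)"
    using assms(1) unfolding bounded_multilinear_def by blast
  obtain L where L: "\<And>vs. length vs = n \<Longrightarrow> norm (B vs) \<le> L * prod_list (map norm vs)"
    using assms(2) unfolding bounded_multilinear_def by blast
  have "norm (A vs - B vs) \<le> (K + L) * prod_list (map norm vs)" if "length vs = n" for vs
    using K[OF that] L[OF that] norm_triangle_ineq4[of "A vs" "B vs"] by (simp add: distrib_right)
  moreover have "linear (\<lambda>v. A (vs[i := v]) - B (vs[i := v]))" if "length vs = n" "i < n" for vs i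
    using assms that unfolding bounded_multilinear_def by (intro linear_compose_sub) auto
  ultimately show ?thesis unfolding bounded_multilinear_def by blast
qed

lemma multilinear_norm_cong:
  assumes "\<And>vs. length vs = n \<Longrightarrow> A vs = B vs"
  shows "multilinear_norm n A = multilinear_norm n B"
  unfolding multilinear_norm_def by (rule SUP_cong) (use assms in auto)

text \<open>Exchanging \<open>y\<close> for \<open>x\<close> one argument at a time gives a
  telescoping sum of \<open>n\<close> differences; each is linear in \<open>x - y\<close> and has
  \<open>n - 1\<close> further arguments of norm at most \<open>M\<close>.\<close>

lemma multilinear_diagonal_diff:
  assumes A: "bounded_multilinear n A" and x: "norm x \<le> M" and y: "norm y \<le> M"
  shows "norm (A (replicate n x) - A (replicate n y))
    \<le> real n * (multilinear_norm n A * M ^ (n - 1)) * norm (x - y)"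
proof -
  have M: "0 \<le> M" using x norm_ge_zero order_trans by blast
  define L where "L i = A (replicate i x @ replicate (n - i) y)" for i
  have step: "norm (L (Suc i) - L i) \<le> multilinear_norm n A * M ^ (n - 1) * norm (x - y)"
    if i: "i < n" for i
  proof -
    define ps qs where "ps = replicate i x" and "qs = replicate (n - Suc i) y"
    have len: "length ps + Suc (length qs) = n" using i by (simp add: ps_def qs_def)
    have 1: "L (Suc i) = A (ps @ x # qs)"
      by (simp add: L_def ps_def qs_def replicate_app_Cons_same)
    have "replicate (n - i) y = y # qs"
      using i unfolding qs_def by (metis Suc_diff_Suc replicate_Suc)
    then have 2: "L i = A (ps @ y # qs)" by (simp add: L_def ps_def)
    have "L (Suc i) - L i = A (ps @ (x - y) # qs)"
      unfolding 1 2 using linear_diff[OF bounded_multilinearD[OF A len]] by metis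
    then have "norm (L (Suc i) - L i) \<le> multilinear_norm n A * prod_list (map norm (ps @ (x - y) # qs))"
      using multilinear_norm_bound[OF A, of "ps @ (x - y) # qs"] len by simp
    also have "prod_list (map norm (ps @ (x - y) # qs)) = norm x ^ i * norm y ^ (n - Suc i) * norm (x - y)"
      by (simp add: ps_def qs_def prod_list_replicate)
    also have "\<dots> \<le> (M ^ i * M ^ (n - Suc i)) * norm (x - y)"
      by (intro mult_right_mono mult_mono power_mono x y) (use M in auto)
    also have "M ^ i * M ^ (n - Suc i) = M ^ (n - 1)"
      using i by (simp flip: power_add)
    finally show ?thesis
      using multilinear_norm_nonneg[OF A] by (simp add: mult_left_mono mult.assoc)
  qed
  have "A (replicate n x) - A (replicate n y) = (\<Sum>i<n. L (Suc i) - L i)"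
    by (subst sum_lessThan_telescope) (simp add: L_def)
  also have "norm \<dots> \<le> (\<Sum>i<n. multilinear_norm n A * M ^ (n - 1) * norm (x - y))"
    by (rule sum_norm_le) (use step in auto)
  finally show ?thesis by (simp add: mult_ac)
qed

text \<open>A 0-linear map is its value at \<open>[]\<close>, with the same norm, so level 0 of
  \<open>smooth_map_on\<close> is the defining limit of the derivative. Boundedness of the
  derivative comes from level 1.\<close>

lemma smooth_map_has_derivative:
  assumes F: "smooth_map_on F S" and x: "x \<in> S"
  shows "(F has_derivative frechet_derivative F (at x)) (at x)"
proof -
  let ?D = "frechet_derivative F (at x)"
  have D: "nth_frechet (Suc 0) F x [v] = ?D v" for v by simp
  have A: "bounded_multilinear (Suc 0) (nth_frechet (Suc 0) F x)"
    using F x unfolding smooth_map_on_def by blast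
  have lin: "linear ?D" using bounded_multilinearD[OF A, of "[]" "[]"] by simp
  obtain K where "\<And>vs. length vs = Suc 0 \<Longrightarrow> norm (nth_frechet (Suc 0) F x vs) \<le> K * prod_list (map norm vs)"
    using A unfolding bounded_multilinear_def by blast
  from this[of "[v]" for v] have "norm (?D v) \<le> norm v * K" for v by (simp add: mult.commute)
  then have bl: "bounded_linear ?D"
    using lin unfolding bounded_linear_def bounded_linear_axioms_def by blast
  have n0: "multilinear_norm 0 B = norm (B [])" for B :: "'a list \<Rightarrow> 'b"
    proof -
    have "{vs :: 'a list. length vs = 0 \<and> (\<forall>v\<in>set vs. norm v \<le> 1)} = {[]}" by auto
    then show ?thesis unfolding multilinear_norm_def by simp
  qed
  have "((\<lambda>h. multilinear_norm 0 (\<lambda>vs. nth_frechet 0 F (x + h) vs - nth_frechet 0 F x vs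
                                    - nth_frechet (Suc 0) F x (h # vs)) / norm h) \<longlongrightarrow> 0) (at 0)"
    using F x unfolding smooth_map_on_def by blast
  then show ?thesis by (simp add: n0 has_derivative_at bl)
qed

section \<open>Maximal monotone operators\<close>

lemma monotoneD:
  assumes "monotone_operator T" "u \<in> T x" "v \<in> T y"
  shows "0 \<le> (u - v) \<bullet> (x - y)"
  using assms unfolding monotone_operator_def operator_domain_def by blast

lemma maximal_monotoneI:
  assumes "maximal_monotone_operator T" "\<And>y v. v \<in> T y \<Longrightarrow> 0 \<le> (u - v) \<bullet> (x - y)"
  shows "u \<in> T x"
  using assms unfolding maximal_monotone_operator_def by blast

text \<open>With the inner product stored as third coordinate, the monotonicity inequality between
  two graph points is affine in each of them. It therefore extends to the hull in one point, then in
  the other; for two equal hull points it reads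
  \<open>0 \<le> 2 * (w - b \<bullet> a)\<close>.\<close>

lemma monotone_hull_inner_le:
  fixes T :: "'a::real_inner \<Rightarrow> 'a set"
  assumes T: "monotone_operator T"
    and p: "(a, b, w) \<in> convex hull {(y, v, v \<bullet> y) |y v. v \<in> T y}"
  shows "b \<bullet> a \<le> w"
proof -
  let ?G = "{(y, v, v \<bullet> y) |y v. v \<in> T y}"
  have half: "convex {(a :: 'a, b, w :: real). 0 \<le> w - b \<bullet> y - v \<bullet> a + z}" for y v z
  proof -
    have "{(a :: 'a, b, w :: real). 0 \<le> w - b \<bullet> y - v \<bullet> a + z} = {p. (v, y, -1) \<bullet> p \<le> z}"
      by (auto simp: inner_prod_def inner_commute)
    then show ?thesis by (simp only: convex_halfspace_le)
  qed
  have 1: "0 \<le> w - b \<bullet> y - v \<bullet> a + v \<bullet> y" if "v \<in> T y" for y v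
  proof -
    have "convex hull ?G \<subseteq> {(a, b, w). 0 \<le> w - b \<bullet> y - v \<bullet> a + v \<bullet> y}"
    proof (rule hull_minimal)
      show "?G \<subseteq> {(a, b, w). 0 \<le> w - b \<bullet> y - v \<bullet> a + v \<bullet> y}"
        using monotoneD[OF T _ that] by (force simp: inner_diff_left inner_diff_right)
    qed (rule half)
    then show ?thesis using p by blast
  qed
  have "convex hull ?G \<subseteq> {(y, v, u). 0 \<le> u - v \<bullet> a - b \<bullet> y + w}"
  proof (rule hull_minimal)
    show "?G \<subseteq> {(y, v, u). 0 \<le> u - v \<bullet> a - b \<bullet> y + w}" using 1 by force
  qed (rule half)
  then have "0 \<le> w - b \<bullet> a - b \<bullet> a + w" using p by blast
  then show ?thesis by simp
qed

text \<open>
  The condition \<open>\<langle>x + v, x - y\<rangle> \<le> 0\<close> on \<open>x\<close> is \<open>\<parallel>x\<parallel>\<^sup>2 - 2 * \<langle>x, c\<rangle> - \<langle>v, y\<rangle> \<le> 0\<close> with \<open>c = (y - v) / 2\<close>. Let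
  \<open>D\<close> be the dual functional \<open>- \<parallel>c\<parallel>\<^sup>2 - w\<close> on the convex hull of the points \<open>(y, v, \<langle>v, y\<rangle>)\<close>. It is
  nonpositive by monotonicity and strongly concave in \<open>c\<close>. Hence the \<open>c\<close>-parts of a maximizing
  sequence converge, and the first-order condition says that the limit satisfies all the conditions.
\<close>

lemma minty_zero:
  fixes T :: "'a::{real_inner, banach} \<Rightarrow> 'a set"
  assumes T: "maximal_monotone_operator T"
  shows "\<exists>x. - x \<in> T x"
proof -
  have mono: "monotone_operator T" using T unfolding maximal_monotone_operator_def by blast
  define G where "G = {(y, v, v \<bullet> y) |y v. v \<in> T y}"
  define C where "C = convex hull G"
  define z where "z p = (1/2) *\<^sub>R (fst p - fst (snd p))" for p :: "'a \<times> 'a \<times> real"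
  define D where "D p = - (norm (z p))\<^sup>2 - snd (snd p)" for p
  have z_add: "z (s *\<^sub>R p + t *\<^sub>R q) = s *\<^sub>R z p + t *\<^sub>R z q" for s t p q
    by (simp add: z_def algebra_simps)
  have D_le: "D p \<le> 0" if "p \<in> C" for p
  proof -
    obtain a b w where p: "p = (a, b, w)" by (metis prod_cases3)
    have "b \<bullet> a \<le> w" using monotone_hull_inner_le[OF mono] that unfolding p C_def G_def by blast
    moreover have "0 \<le> (a + b) \<bullet> (a + b)" by simp
    ultimately show ?thesis
      by (simp add: D_def z_def p power2_norm_eq_inner inner_add_left inner_add_right
          inner_diff_left inner_diff_right inner_commute field_simps)
  qed
  \<comment> \<open>If the graph were empty, every pair would vacuously satisfy the maximality
    condition and so belong to it.\<close>
  have "\<exists>y v. v \<in> T y" using maximal_monotoneI[OF T] by blast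
  then have ne: "G \<noteq> {}" unfolding G_def by blast
  have GC: "G \<subseteq> C" unfolding C_def by (rule hull_subset)
  have cvx: "convex C" unfolding C_def by (rule convex_convex_hull)
  define d where "d = (SUP p\<in>C. D p)"
  have bdd: "bdd_above (D ` C)" using D_le by (intro bdd_aboveI2[of _ _ 0]) blast
  have D_d: "D p \<le> d" if "p \<in> C" for p
    unfolding d_def by (rule cSUP_upper[OF that bdd])
  have d0: "d \<le> 0" unfolding d_def by (rule cSUP_least) (use ne GC D_le in auto)
  have "\<exists>p. p \<in> C \<and> d - 1 / real (Suc n) < D p" for n
  proof -
    have "d - 1 / real (Suc n) < (SUP p\<in>C. D p)" unfolding d_def[symmetric] by simp
    then show ?thesis using less_cSUP_iff[OF _ bdd] ne GC by (metis subset_empty)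
  qed
  then obtain p where pC: "\<And>n. p n \<in> C" and pD: "\<And>n. d - 1 / real (Suc n) < D (p n)" by metis
  have Dlim: "(\<lambda>n. D (p n)) \<longlonglongrightarrow> d"
  proof (rule tendsto_sandwich)
    show "\<forall>\<^sub>F n in sequentially. d - 1 / real (Suc n) \<le> D (p n)" using pD by (simp add: less_imp_le)
    show "\<forall>\<^sub>F n in sequentially. D (p n) \<le> d" using D_d pC by simp
    have "(\<lambda>n. d - 1 / real (Suc n)) \<longlonglongrightarrow> d - 0"
      by (intro tendsto_intros LIMSEQ_Suc[OF lim_1_over_n])
    then show "(\<lambda>n. d - 1 / real (Suc n)) \<longlonglongrightarrow> d" by simp
  qed simp
  \<comment> \<open>The midpoint stays in the hull, where \<open>D\<close> is at most
    \<open>d\<close>; the parallelogram identity then bounds the distance of the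
    \<open>z\<close>-parts.\<close>
  have close: "(norm (z p - z q))\<^sup>2 \<le> 4 * d - 2 * D p - 2 * D q" if "p \<in> C" "q \<in> C" for p q
  proof -
    have "(1/2) *\<^sub>R p + (1/2) *\<^sub>R q \<in> C" using cvx that unfolding convex_def by force
    from D_d[OF this] show ?thesis
      unfolding D_def z_add
      by (simp add: power2_norm_eq_inner inner_add_left inner_add_right
          inner_diff_left inner_diff_right inner_commute field_simps)
  qed
  have "Cauchy (\<lambda>n. z (p n))"
  proof (rule metric_CauchyI)
    fix e :: real assume e: "0 < e"
    have "\<forall>\<^sub>F n in sequentially. d - e\<^sup>2 / 4 < D (p n)"
      using order_tendstoD(1)[OF Dlim] e by simp
    then obtain N where N: "\<And>n. n \<ge> N \<Longrightarrow> d - e\<^sup>2 / 4 < D (p n)"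
      unfolding eventually_sequentially by blast
    have "dist (z (p m)) (z (p n)) < e" if "m \<ge> N" "n \<ge> N" for m n
    proof -
      have "(norm (z (p m) - z (p n)))\<^sup>2 < e\<^sup>2"
        using close[OF pC pC, of m n] N[OF that(1)] N[OF that(2)] by linarith
      then show ?thesis using e by (simp add: dist_norm power2_less_imp_less)
    qed
    then show "\<exists>M. \<forall>m\<ge>M. \<forall>n\<ge>M. dist (z (p m)) (z (p n)) < e" by blast
  qed
  then obtain x where x: "(\<lambda>n. z (p n)) \<longlonglongrightarrow> x" using Cauchy_convergent_iff convergent_def by blast
  \<comment> \<open>\<open>D\<close> sees a point only through \<open>z\<close> and the third
    coordinate, so the limits of these two replace a maximizer.\<close>
  have wlim: "(\<lambda>n. snd (snd (p n))) \<longlonglongrightarrow> - d - (norm x)\<^sup>2"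
  proof -
    have "(\<lambda>n. - D (p n) - (norm (z (p n)))\<^sup>2) \<longlonglongrightarrow> - d - (norm x)\<^sup>2"
      by (intro tendsto_intros Dlim x)
    then show ?thesis by (simp add: D_def)
  qed
  have key: "(norm x)\<^sup>2 - 2 * (x \<bullet> z q) - snd (snd q) \<le> d" if q: "q \<in> G" for q
  proof -
    \<comment> \<open>On the segment from \<open>p n\<close> to \<open>q\<close>, \<open>D\<close>
      cannot exceed \<open>d\<close> at parameter \<open>s\<close>. First \<open>n\<close> tends to
      infinity; after division by \<open>s\<close>, the parameter tends to 0.\<close>
    have ineq: "2 * (x \<bullet> x) - 2 * (x \<bullet> z q) + (- d - (norm x)\<^sup>2) - snd (snd q)
          \<le> s * (norm (z q - x))\<^sup>2" if s: "0 < s" "s < 1" for s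
    proof -
      have "D (p n) + s * (2 * (z (p n) \<bullet> z (p n)) - 2 * (z (p n) \<bullet> z q) + snd (snd (p n)) - snd (snd q))
          - s\<^sup>2 * (norm (z q - z (p n)))\<^sup>2 \<le> d" for n
      proof -
        have "(1 - s) *\<^sub>R p n + s *\<^sub>R q \<in> C"
          using cvx pC[of n] q GC s unfolding convex_def by (metis add.commute diff_add_cancel diff_ge_0_iff_ge less_imp_le subsetD)
        note D_d[OF this]
        moreover have "(norm ((1 - s) *\<^sub>R z (p n) + s *\<^sub>R z q))\<^sup>2
            = (norm (z (p n)))\<^sup>2 - s * (2 * (z (p n) \<bullet> z (p n)) - 2 * (z (p n) \<bullet> z q))
              + s\<^sup>2 * (norm (z q - z (p n)))\<^sup>2"
          unfolding power2_norm_eq_inner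
          by (simp add: inner_add_left inner_add_right inner_diff_left inner_diff_right
              inner_commute algebra_simps power2_eq_square)
        ultimately show ?thesis unfolding D_def z_add by (simp add: algebra_simps)
      qed
      moreover have "(\<lambda>n. D (p n) + s * (2 * (z (p n) \<bullet> z (p n)) - 2 * (z (p n) \<bullet> z q) + snd (snd (p n)) - snd (snd q))
          - s\<^sup>2 * (norm (z q - z (p n)))\<^sup>2) \<longlonglongrightarrow>
          d + s * (2 * (x \<bullet> x) - 2 * (x \<bullet> z q) + (- d - (norm x)\<^sup>2) - snd (snd q)) - s\<^sup>2 * (norm (z q - x))\<^sup>2"
        by (intro tendsto_intros Dlim x wlim)
      ultimately have "d + s * (2 * (x \<bullet> x) - 2 * (x \<bullet> z q) + (- d - (norm x)\<^sup>2) - snd (snd q))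
          - s\<^sup>2 * (norm (z q - x))\<^sup>2 \<le> d"
        by (intro LIMSEQ_le_const2) auto
      then have "s * (2 * (x \<bullet> x) - 2 * (x \<bullet> z q) + (- d - (norm x)\<^sup>2) - snd (snd q))
          \<le> s * (s * (norm (z q - x))\<^sup>2)" by (simp add: power2_eq_square mult.assoc)
      then show ?thesis using s by simp
    qed
    have "((\<lambda>s. s * (norm (z q - x))\<^sup>2) \<longlongrightarrow> 0 * (norm (z q - x))\<^sup>2) (at_right 0)"
      by (intro tendsto_intros)
    moreover have "\<forall>\<^sub>F s in at_right (0::real). 2 * (x \<bullet> x) - 2 * (x \<bullet> z q) + (- d - (norm x)\<^sup>2) - snd (snd q)
          \<le> s * (norm (z q - x))\<^sup>2"
      using eventually_at_right_real[OF zero_less_one] by eventually_elim (use ineq in auto)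
    ultimately have "2 * (x \<bullet> x) - 2 * (x \<bullet> z q) + (- d - (norm x)\<^sup>2) - snd (snd q) \<le> 0 * (norm (z q - x))\<^sup>2"
      by (rule tendsto_lowerbound) simp
    then show ?thesis by (simp add: power2_norm_eq_inner)
  qed
  have "- x \<in> T x"
  proof (rule maximal_monotoneI[OF T])
    fix y v assume "v \<in> T y"
    then have "(y, v, v \<bullet> y) \<in> G" unfolding G_def by blast
    from key[OF this] d0 show "0 \<le> (- x - v) \<bullet> (x - y)"
      by (simp add: z_def power2_norm_eq_inner inner_diff_left inner_diff_right inner_commute diff_divide_distrib)
  qed
  then show ?thesis by blast
qed

text \<open>\<open>S\<close> is the rescaled and shifted operator \<open>l T - z\<close>. It is
  again maximal monotone, and \<open>- x \<in> S x\<close> is the resolvent inclusion for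
  \<open>T\<close>.\<close>

lemma minty:
  fixes T :: "'a::{real_inner, banach} \<Rightarrow> 'a set"
  assumes T: "maximal_monotone_operator T" and l: "0 < l"
  shows "\<exists>x. (1 / l) *\<^sub>R (z - x) \<in> T x"
proof -
  define S where "S x = {u. (1 / l) *\<^sub>R (u + z) \<in> T x}" for x
  have mono: "monotone_operator T" using T unfolding maximal_monotone_operator_def by blast
  have dS: "v \<in> T y \<Longrightarrow> l *\<^sub>R v - z \<in> S y" for v y using l by (simp add: S_def)
  have "maximal_monotone_operator S"
    unfolding maximal_monotone_operator_def
  proof (intro conjI allI impI)
    show "monotone_operator S"
      unfolding monotone_operator_def
    proof (intro ballI)
      fix x y u v assume "u \<in> S y" "v \<in> S x"
      then have "0 \<le> ((1 / l) *\<^sub>R (u + z) - (1 / l) *\<^sub>R (v + z)) \<bullet> (y - x)"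
        unfolding S_def by (intro monotoneD[OF mono]) auto
      also have "\<dots> = (1 / l) * ((u - v) \<bullet> (y - x))" by (simp flip: scaleR_diff_right)
      finally show "0 \<le> (u - v) \<bullet> (y - x)" using l by (simp add: zero_le_divide_iff)
    qed
    fix x u assume h: "\<forall>y\<in>operator_domain S. \<forall>v\<in>S y. 0 \<le> (u - v) \<bullet> (x - y)"
    have "(1 / l) *\<^sub>R (u + z) \<in> T x"
    proof (rule maximal_monotoneI[OF T])
      fix y v assume "v \<in> T y"
      then have "0 \<le> (u - (l *\<^sub>R v - z)) \<bullet> (x - y)"
        using h dS unfolding operator_domain_def by blast
      then have "0 \<le> (1 / l) * ((u - (l *\<^sub>R v - z)) \<bullet> (x - y))" using l by simp
      also have "\<dots> = ((1 / l) *\<^sub>R (u + z) - v) \<bullet> (x - y)"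
        unfolding inner_scaleR_left[symmetric] using l by (simp add: scaleR_diff_right scaleR_add_right algebra_simps)
      finally show "0 \<le> ((1 / l) *\<^sub>R (u + z) - v) \<bullet> (x - y)" .
    qed
    then show "u \<in> S x" by (simp add: S_def)
    then show "x \<in> operator_domain S" unfolding operator_domain_def by blast
  qed
  from minty_zero[OF this] show ?thesis by (auto simp: S_def)
qed

section \<open>Unique solvability of strongly monotone inclusions\<close>

lemma strongly_monotone_unique:
  assumes T: "monotone_operator T" and c: "0 < c" and M: "linear M" "\<And>v. c * (norm v)\<^sup>2 \<le> M v \<bullet> v"
    and "b - M x \<in> T x" "b - M y \<in> T y"
  shows "x = y"
proof -
  have "0 \<le> ((b - M x) - (b - M y)) \<bullet> (x - y)" by (rule monotoneD[OF T]) fact+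
  also have "\<dots> = - (M (x - y) \<bullet> (x - y))" by (simp add: linear_diff[OF M(1)] flip: inner_minus_left)
  also have "\<dots> \<le> - (c * (norm (x - y))\<^sup>2)" using M(2) by simp
  finally show ?thesis using c by (simp add: mult_le_0_iff)
qed

text \<open>A solution is a fixed point of the resolvent composed with a gradient-type step, and this map
  is a contraction for a small step length.\<close>

lemma strongly_monotone_solvable:
  fixes T :: "'a::{real_inner, banach} \<Rightarrow> 'a set"
  assumes T: "maximal_monotone_operator T" and c: "0 < c"
    and M: "bounded_linear M" "\<And>v. c * (norm v)\<^sup>2 \<le> M v \<bullet> v"
  shows "\<exists>!y. b - M y \<in> T y"
proof -
  have mono: "monotone_operator T" using T unfolding maximal_monotone_operator_def by blast
  obtain L where L: "0 < L" "\<And>v. norm (M v) \<le> norm v * L"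
    using bounded_linear.pos_bounded[OF M(1)] by blast
  \<comment> \<open>The map \<open>v \<mapsto> v - l M v\<close> has squared Lipschitz constant at
    most \<open>1 - 2 * l * c + l\<^sup>2 * L\<^sup>2\<close>. This \<open>l\<close> brings it below
    \<open>k = L\<^sup>2 / (c\<^sup>2 + L\<^sup>2)\<close>, which lies between 0 and 1 whatever the
    order of \<open>c\<close> and \<open>L\<close>.\<close>
  define l where "l = c / (c\<^sup>2 + L\<^sup>2)"
  have den: "0 < c\<^sup>2 + L\<^sup>2" using c by (simp add: add_pos_nonneg)
  have l: "0 < l" using c den by (simp add: l_def)
  define k where "k = 1 - c\<^sup>2 / (c\<^sup>2 + L\<^sup>2)"
  have k: "0 \<le> k" "k < 1" using c den by (auto simp: k_def field_simps)
  have k_ge: "1 - 2 * l * c + l\<^sup>2 * L\<^sup>2 \<le> k"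
  proof -
    have "l * (c\<^sup>2 + L\<^sup>2) = c" using den by (simp add: l_def)
    then have "l * (l * (c\<^sup>2 + L\<^sup>2)) = l * c" by simp
    then have "l\<^sup>2 * L\<^sup>2 = l * c - l\<^sup>2 * c\<^sup>2" by (simp add: power2_eq_square algebra_simps)
    moreover have "c\<^sup>2 / (c\<^sup>2 + L\<^sup>2) = l * c" by (simp add: l_def power2_eq_square)
    ultimately show ?thesis by (simp add: k_def)
  qed
  have contr: "(norm (v - l *\<^sub>R M v))\<^sup>2 \<le> k * (norm v)\<^sup>2" for v
  proof -
    have "(norm (M v))\<^sup>2 \<le> (norm v * L)\<^sup>2" by (intro power_mono L) simp
    then have "l\<^sup>2 * (norm (M v))\<^sup>2 \<le> l\<^sup>2 * (norm v * L)\<^sup>2" by (rule mult_left_mono) simp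
    moreover have "2 * l * (c * (norm v)\<^sup>2) \<le> 2 * l * (M v \<bullet> v)"
      using l by (intro mult_left_mono M(2)) simp
    moreover have "(norm (v - l *\<^sub>R M v))\<^sup>2 = (norm v)\<^sup>2 - 2 * l * (M v \<bullet> v) + l\<^sup>2 * (norm (M v))\<^sup>2"
      unfolding power2_norm_eq_inner
      by (simp add: inner_diff_left inner_diff_right inner_commute algebra_simps power2_eq_square)
    ultimately have "(norm (v - l *\<^sub>R M v))\<^sup>2 \<le> (norm v)\<^sup>2 - 2 * l * (c * (norm v)\<^sup>2) + l\<^sup>2 * (norm v * L)\<^sup>2"
      by linarith
    also have "\<dots> = (1 - 2 * l * c + l\<^sup>2 * L\<^sup>2) * (norm v)\<^sup>2"
      by (simp add: algebra_simps power2_eq_square)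
    also have "\<dots> \<le> k * (norm v)\<^sup>2" by (intro mult_right_mono k_ge) simp
    finally show ?thesis .
  qed
  obtain J where J: "\<And>z. (1 / l) *\<^sub>R (z - J z) \<in> T (J z)" using minty[OF T l] by metis
  \<comment> \<open>Monotonicity of \<open>T\<close> at the two resolvent points is firm
    nonexpansiveness of \<open>J\<close>; Cauchy-Schwarz weakens it to the claim.\<close>
  have J_nonexp: "norm (J z - J w) \<le> norm (z - w)" for z w
  proof -
    have "0 \<le> ((1 / l) *\<^sub>R (z - J z) - (1 / l) *\<^sub>R (w - J w)) \<bullet> (J z - J w)"
      by (rule monotoneD[OF mono J J])
    also have "(1 / l) *\<^sub>R (z - J z) - (1 / l) *\<^sub>R (w - J w) = (1 / l) *\<^sub>R ((z - w) - (J z - J w))"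
      by (simp add: algebra_simps)
    also have "\<dots> \<bullet> (J z - J w) = (1 / l) * (((z - w) - (J z - J w)) \<bullet> (J z - J w))"
      by (rule inner_scaleR_left)
    finally have "0 \<le> ((z - w) - (J z - J w)) \<bullet> (J z - J w)"
      using l by (simp add: zero_le_divide_iff)
    then have "(norm (J z - J w))\<^sup>2 \<le> (z - w) \<bullet> (J z - J w)"
      by (simp add: inner_diff_left power2_norm_eq_inner)
    also have "\<dots> \<le> norm (z - w) * norm (J z - J w)" by (rule norm_cauchy_schwarz)
    finally show ?thesis
      by (cases "J z = J w") (auto simp: power2_eq_square)
  qed
  define f where "f y = J (y - l *\<^sub>R (M y - b))" for y
  have "dist (f x) (f y) \<le> sqrt k * dist x y" for x y
  proof -
    have "norm (f x - f y) \<le> norm ((x - l *\<^sub>R (M x - b)) - (y - l *\<^sub>R (M y - b)))"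
      unfolding f_def by (rule J_nonexp)
    also have "(x - l *\<^sub>R (M x - b)) - (y - l *\<^sub>R (M y - b)) = (x - y) - l *\<^sub>R M (x - y)"
      by (simp add: linear_diff[OF bounded_linear.linear[OF M(1)]] algebra_simps)
    also have "norm \<dots> \<le> sqrt (k * (norm (x - y))\<^sup>2)"
      by (rule real_le_rsqrt) (rule contr)
    finally show ?thesis by (simp add: dist_norm real_sqrt_mult)
  qed
  then have "\<exists>!y. f y = y"
    using k by (intro banach_fix_type[of "sqrt k"]) auto
  then obtain y where "f y = y" by blast
  then have "(1 / l) *\<^sub>R ((y - l *\<^sub>R (M y - b)) - y) \<in> T y"
    using J[of "y - l *\<^sub>R (M y - b)"] by (simp add: f_def)
  then have "b - M y \<in> T y" using l by simp
  then show ?thesis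
    using strongly_monotone_unique[OF mono c bounded_linear.linear[OF M(1)] M(2)] by blast
qed

section \<open>The identity theorem along segments\<close>

text \<open>Analyticity is expressed by a local holomorphic extension, so that the complex identity theorem
  applies and power series need not be re-expanded.\<close>

definition real_analytic_at :: "(real \<Rightarrow> real) \<Rightarrow> real \<Rightarrow> bool" where
  "real_analytic_at f t \<longleftrightarrow> (\<exists>g e. 0 < e \<and> g holomorphic_on ball (complex_of_real t) e \<and>
     (\<forall>s. \<bar>s - t\<bar> < e \<longrightarrow> g (of_real s) = of_real (f s)))"

text \<open>The same coefficients define the complex extension: convergence at a real point at
  distance \<open>y\<close> from \<open>c\<close> forces convergence in the open complex disc of
  radius \<open>y\<close>.\<close>

lemma real_analytic_at_power_series:
  assumes f: "\<And>s. \<bar>s - c\<bar> < R \<Longrightarrow> (\<lambda>n. a n * (s - c) ^ n) sums f s" and t: "\<bar>t - c\<bar> < R"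
  shows "real_analytic_at f t"
proof -
  define g where "g z = (\<Sum>n. complex_of_real (a n) * (z - of_real c) ^ n)" for z
  have sm: "(\<lambda>n. complex_of_real (a n) * (z - of_real c) ^ n) sums g z"
    if z: "z \<in> ball (of_real c) R" for z
  proof -
    have "norm (z - of_real c) < R" using z by (simp add: dist_norm norm_minus_commute)
    then obtain y where y: "norm (z - of_real c) < y" "y < R" using dense by blast
    have "0 \<le> norm (z - of_real c)" by simp
    then have y0: "0 < y" using y(1) by linarith
    have "summable (\<lambda>n. a n * y ^ n)" using f[of "c + y"] y y0 by (auto simp: sums_iff)
    then have "summable (\<lambda>n. complex_of_real (a n * y ^ n))" by (rule summable_of_real)
    then have "summable (\<lambda>n. complex_of_real (a n) * complex_of_real y ^ n)" by simp
    from powser_inside[OF this, of "z - of_real c"] y y0 show ?thesis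
      by (simp add: g_def summable_sums)
  qed
  have holo: "g holomorphic_on ball (of_real c) R" by (rule power_series_holomorphic[OF sm])
  have sub: "ball (complex_of_real t) (R - \<bar>t - c\<bar>) \<subseteq> ball (of_real c) R"
  proof
    fix z assume "z \<in> ball (complex_of_real t) (R - \<bar>t - c\<bar>)"
    moreover have "dist (of_real c) (complex_of_real t) = \<bar>t - c\<bar>"
      by (metis abs_minus_commute dist_norm norm_of_real of_real_diff)
    ultimately show "z \<in> ball (of_real c) R"
      using dist_triangle[of "of_real c" z "of_real t"] by simp
  qed
  have "g (of_real s) = of_real (f s)" if "\<bar>s - t\<bar> < R - \<bar>t - c\<bar>" for s
  proof -
    have "\<bar>s - c\<bar> < R" using that by linarith
    from sums_of_real[OF f[OF this], where 'a = complex] show ?thesis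
      unfolding g_def by (simp add: sums_iff)
  qed
  then show ?thesis
    unfolding real_analytic_at_def using holomorphic_on_subset[OF holo sub] t
    by (intro exI[of _ g] exI[of _ "R - \<bar>t - c\<bar>"]) auto
qed

lemma real_analytic_at_diff:
  assumes "real_analytic_at f t" "real_analytic_at g t"
  shows "real_analytic_at (\<lambda>s. f s - g s) t"
proof -
  obtain f' d where f': "0 < d" "f' holomorphic_on ball (complex_of_real t) d"
      "\<And>s. \<bar>s - t\<bar> < d \<Longrightarrow> f' (of_real s) = of_real (f s)"
    using assms(1) unfolding real_analytic_at_def by blast
  obtain g' e where g': "0 < e" "g' holomorphic_on ball (complex_of_real t) e"
      "\<And>s. \<bar>s - t\<bar> < e \<Longrightarrow> g' (of_real s) = of_real (g s)"
    using assms(2) unfolding real_analytic_at_def by blast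
  have "(\<lambda>z. f' z - g' z) holomorphic_on ball (complex_of_real t) (min d e)"
    by (intro holomorphic_on_diff holomorphic_on_subset[OF f'(2)] holomorphic_on_subset[OF g'(2)]) auto
  then show ?thesis
    unfolding real_analytic_at_def using f' g'
    by (intro exI[of _ "\<lambda>z. f' z - g' z"] exI[of _ "min d e"]) auto
qed

text \<open>Either the zeros of the extension accumulate at \<open>t\<close>, and then it vanishes
  on the whole disc, or they stay away from \<open>t\<close> in a punctured disc. Both cases
  restrict to the real axis.\<close>

lemma real_analytic_at_zero_cases:
  assumes "real_analytic_at f t"
  shows "(\<forall>\<^sub>F s in nhds t. f s = 0) \<or> (\<forall>\<^sub>F s in at t. f s \<noteq> 0)"
proof -
  obtain g e where e: "0 < e" and g: "g holomorphic_on ball (complex_of_real t) e"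
    and gf: "\<And>s. \<bar>s - t\<bar> < e \<Longrightarrow> g (of_real s) = of_real (f s)"
    using assms unfolding real_analytic_at_def by blast
  let ?B = "ball (complex_of_real t) e"
  have near: "\<forall>\<^sub>F s in nhds t. \<bar>s - t\<bar> < e"
    using e unfolding eventually_nhds_metric by (auto simp: dist_real_def)
  have inB: "of_real s \<in> ?B" if "\<bar>s - t\<bar> < e" for s
    using that by (simp add: dist_norm norm_minus_commute flip: of_real_diff)
  show ?thesis
  proof (cases "complex_of_real t islimpt {z \<in> ?B. g z = 0}")
    case True
    have gz: "g z = 0" if "z \<in> ?B" for z
      by (rule analytic_continuation[OF g open_ball connected_ball _ _ True _ that]) (use e in auto)
    have "\<forall>\<^sub>F s in nhds t. f s = 0"
      using near by eventually_elim (use gf inB gz in force)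
    then show ?thesis ..
  next
    case False
    then have "\<forall>\<^sub>F z in at (complex_of_real t). z \<notin> {z \<in> ?B. g z = 0}"
      by (simp add: islimpt_iff_eventually)
    moreover have "filterlim complex_of_real (at (of_real t)) (at t)"
      by (rule filterlim_atI) (auto intro!: tendsto_intros simp: eventually_at_filter)
    ultimately have "\<forall>\<^sub>F s in at t. complex_of_real s \<notin> {z \<in> ?B. g z = 0}"
      unfolding filterlim_iff by blast
    moreover have "\<forall>\<^sub>F s in at t. \<bar>s - t\<bar> < e"
      using near by (simp add: eventually_nhds_conv_at)
    ultimately have "\<forall>\<^sub>F s in at t. f s \<noteq> 0"
      by eventually_elim (use gf inB in force)
    then show ?thesis ..
  qed
qed

text \<open>The two alternatives of \<open>real_analytic_at_zero_cases\<close> are open conditions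
  that exclude each other and cover \<open>J\<close>. By connectedness the one that holds at
  \<open>c\<close> holds everywhere.\<close>

lemma real_analytic_identity:
  assumes J: "open J" "connected J" and f: "\<And>t. t \<in> J \<Longrightarrow> real_analytic_at f t"
    and c: "c \<in> J" "\<forall>\<^sub>F s in nhds c. f s = 0" and t: "t \<in> J"
  shows "f t = 0"
proof -
  define A where "A = {t \<in> J. \<forall>\<^sub>F s in nhds t. f s = 0}"
  define B where "B = {t \<in> J. \<forall>\<^sub>F s in at t. f s \<noteq> 0}"
  have nJ: "\<forall>\<^sub>F s in nhds u. s \<in> J" if "u \<in> J" for u
    using J(1) that by (rule eventually_nhds_in_open)
  have "open A"
    unfolding open_subopen[of A]
  proof
    fix u assume "u \<in> A"
    then have "\<forall>\<^sub>F s in nhds u. s \<in> A"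
      using nJ[of u] unfolding A_def by (simp add: eventually_eventually eventually_conj)
    then show "\<exists>T. open T \<and> u \<in> T \<and> T \<subseteq> A" unfolding eventually_nhds by blast
  qed
  moreover have "open B"
    unfolding open_subopen[of B]
  proof
    fix u assume u: "u \<in> B"
    then obtain S where S: "open S" "u \<in> S" "\<And>s. s \<in> S \<Longrightarrow> s \<noteq> u \<Longrightarrow> f s \<noteq> 0"
      unfolding B_def eventually_at_topological by blast
    have "S \<inter> J \<subseteq> B"
    proof
      fix v assume v: "v \<in> S \<inter> J"
      show "v \<in> B"
      proof (cases "v = u")
        case False
        then have "\<forall>\<^sub>F s in nhds v. s \<in> S - {u}"
          using S v by (intro eventually_nhds_in_open) auto
        then have "\<forall>\<^sub>F s in nhds v. f s \<noteq> 0"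
          by eventually_elim (use S in auto)
        then show ?thesis using v by (simp add: B_def eventually_nhds_conv_at)
      qed (use u in simp)
    qed
    then show "\<exists>T. open T \<and> u \<in> T \<and> T \<subseteq> B"
      using S J u by (intro exI[of _ "S \<inter> J"]) (auto simp: B_def)
  qed
  moreover have "J \<subseteq> A \<union> B" using real_analytic_at_zero_cases[OF f] unfolding A_def B_def by blast
  moreover have "A \<inter> B \<inter> J = {}"
  proof -
    have False if u: "\<forall>\<^sub>F s in nhds u. f s = 0" "\<forall>\<^sub>F s in at u. f s \<noteq> 0" for u
    proof -
      have "\<forall>\<^sub>F s in at u. f s = 0" using u(1) by (simp add: eventually_nhds_conv_at)
      with u(2) have "\<forall>\<^sub>F s in at u. False" by eventually_elim simp
      then show False by simp
    qed
    then show ?thesis unfolding A_def B_def by blast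
  qed
  moreover have "A \<inter> J \<noteq> {}" using c unfolding A_def by blast
  ultimately have "B \<inter> J = {}" using connectedD[OF J(2), of A B] by blast
  then have "t \<in> A" using t \<open>J \<subseteq> A \<union> B\<close> by blast
  then show ?thesis unfolding A_def by (auto dest: eventually_nhds_x_imp_x)
qed

section \<open>Taylor expansion on a whole ball\<close>

abbreviation taylor_term :: "('a::real_normed_vector \<Rightarrow> 'b::real_normed_vector) \<Rightarrow> 'a \<Rightarrow> nat \<Rightarrow> 'a \<Rightarrow> 'b" where
  "taylor_term F a n h \<equiv> nth_frechet n F a (replicate n h) /\<^sub>R fact n"

text \<open>The identity theorem is applied to \<open>t \<mapsto> F (a + t h) \<bullet> w\<close> on the segment through \<open>a\<close> and \<open>a + h\<close>.\<close>

lemma analytic_map_taylor_sums: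
  fixes F :: "'a::{real_inner, banach} \<Rightarrow> 'a"
  assumes F: "analytic_map_on F \<Omega>" and sub: "ball a R \<subseteq> \<Omega>"
    and sm: "\<And>k. norm k < R \<Longrightarrow> summable (\<lambda>n. taylor_term F a n k)"
    and h: "norm h < R"
  shows "(\<lambda>n. taylor_term F a n h) sums F (a + h)"
proof (cases "h = 0")
  case True
  have "0 < R" using h le_less_trans norm_ge_zero by blast
  then have "a \<in> \<Omega>" using sub by auto
  then obtain e where "0 < e" "\<forall>x\<in>ball a e. (\<lambda>n. taylor_term F a n (x - a)) sums F x"
    using F unfolding analytic_map_on_def by blast
  then have "(\<lambda>n. taylor_term F a n (a - a)) sums F a" by (metis centre_in_ball)
  then show ?thesis using True by simp
next
  case False
  then have nh: "0 < norm h" by simp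
  \<comment> \<open>In the parameter \<open>t\<close> the ball of radius \<open>R\<close> becomes
    the interval \<open>J\<close>. It contains 0, near which both functions agree, and 1, where
    agreement is wanted.\<close>
  define R' where "R' = R / norm h"
  define J where "J = ball (0::real) R'"
  have J_iff: "t \<in> J \<longleftrightarrow> norm (t *\<^sub>R h) < R" for t
    using nh by (simp add: J_def R'_def pos_less_divide_eq)
  have J_sub: "a + t *\<^sub>R h \<in> \<Omega>" if "t \<in> J" for t
    using that sub by (auto simp: J_iff dist_norm)
  have J0: "0 \<in> J" and J1: "1 \<in> J" using h less_trans[OF nh h] by (auto simp: J_iff)
  have a: "a \<in> \<Omega>" using J_sub[OF J0] by simp
  have ml: "bounded_multilinear n (nth_frechet n F x)" if "x \<in> \<Omega>" for n x
    using F that unfolding analytic_map_on_def smooth_map_on_def by blast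
  have hom: "taylor_term F x n (s *\<^sub>R h) = s ^ n *\<^sub>R taylor_term F x n h" if "x \<in> \<Omega>" for x n s
    by (simp add: multilinear_scale_replicate[OF ml[OF that]])
  define G where "G k = (\<Sum>n. taylor_term F a n k)" for k
  have G: "(\<lambda>n. taylor_term F a n k) sums G k" if "norm k < R" for k
    using sm[OF that] by (simp add: G_def summable_sums)
  have "(F (a + h) - G h) \<bullet> w = 0" for w
  proof -
    define f where "f t = F (a + t *\<^sub>R h) \<bullet> w" for t
    define g where "g t = G (t *\<^sub>R h) \<bullet> w" for t
    \<comment> \<open>For \<open>f\<close> the series of \<open>F\<close> about
      \<open>a + t *\<^sub>R h\<close> is used, with a radius depending on \<open>t\<close>; for
      \<open>g\<close> below, the one series about \<open>a\<close> serves all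
      \<open>t\<close>.\<close>
    have fa: "real_analytic_at f t" if t: "t \<in> J" for t
    proof -
      let ?a = "a + t *\<^sub>R h"
      obtain e where e: "0 < e" "\<And>x. x\<in>ball ?a e \<Longrightarrow> (\<lambda>n. taylor_term F ?a n (x - ?a)) sums F x"
        using F J_sub[OF t] unfolding analytic_map_on_def by blast
      show ?thesis
      proof (rule real_analytic_at_power_series)
        fix s assume "\<bar>s - t\<bar> < e / norm h"
        then have "norm ((s - t) *\<^sub>R h) < e" using nh by (simp add: pos_less_divide_eq)
        moreover have diff: "(a + s *\<^sub>R h) - ?a = (s - t) *\<^sub>R h" by (simp add: algebra_simps)
        ultimately have "a + s *\<^sub>R h \<in> ball ?a e" by (simp add: dist_norm norm_minus_commute)
        from e(2)[OF this] have "(\<lambda>n. taylor_term F ?a n ((s - t) *\<^sub>R h)) sums F (a + s *\<^sub>R h)"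
          unfolding diff .
        then have "(\<lambda>n. taylor_term F ?a n ((s - t) *\<^sub>R h) \<bullet> w) sums f s"
          unfolding f_def by (rule bounded_linear.sums[OF bounded_linear_inner_left])
        then show "(\<lambda>n. (taylor_term F ?a n h \<bullet> w) * (s - t) ^ n) sums f s"
          unfolding hom[OF J_sub[OF t]] inner_scaleR_left by (simp add: mult_ac)
      qed (use e nh in simp)
    qed
    have ga: "real_analytic_at g t" if t: "t \<in> J" for t
    proof (rule real_analytic_at_power_series)
      fix s assume "\<bar>s - 0\<bar> < R'"
      then have "norm (s *\<^sub>R h) < R" using J_iff[of s] by (simp add: J_def)
      from G[OF this] have "(\<lambda>n. taylor_term F a n (s *\<^sub>R h) \<bullet> w) sums g s"
        unfolding g_def by (rule bounded_linear.sums[OF bounded_linear_inner_left])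
      then show "(\<lambda>n. (taylor_term F a n h \<bullet> w) * (s - 0) ^ n) sums g s"
        unfolding hom[OF a] inner_scaleR_left by (simp add: mult_ac)
    qed (use t in \<open>simp add: J_def\<close>)
    have "f 1 - g 1 = 0"
    proof (rule real_analytic_identity[where J = J and c = 0 and f = "\<lambda>t. f t - g t"])
      show "real_analytic_at (\<lambda>t. f t - g t) t" if "t \<in> J" for t
        by (rule real_analytic_at_diff[OF fa[OF that] ga[OF that]])
      obtain e where e: "0 < e" "\<And>x. x\<in>ball a e \<Longrightarrow> (\<lambda>n. taylor_term F a n (x - a)) sums F x"
        using F J_sub[OF J0] unfolding analytic_map_on_def by auto
      have "f s - g s = 0" if "\<bar>s\<bar> < e / norm h" for s
      proof -
        have "norm (s *\<^sub>R h) < e" using that nh by (simp add: pos_less_divide_eq)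
        then have "a + s *\<^sub>R h \<in> ball a e" by (simp add: dist_norm)
        from e(2)[OF this] have "G (s *\<^sub>R h) = F (a + s *\<^sub>R h)" by (simp add: G_def sums_iff)
        then show ?thesis by (simp add: f_def g_def)
      qed
      moreover have "\<forall>\<^sub>F s in nhds 0. \<bar>s\<bar> < e / norm h"
        unfolding eventually_nhds_metric using e nh by (intro exI[of _ "e / norm h"]) (auto simp: dist_real_def)
      ultimately show "\<forall>\<^sub>F s in nhds 0. f s - g s = 0" by (auto elim: eventually_mono)
    qed (use J0 J1 in \<open>auto simp: J_def\<close>)
    then show ?thesis by (simp add: f_def g_def inner_diff_left)
  qed
  \<comment> \<open>The difference is orthogonal to every \<open>w\<close>, in particular to
    itself.\<close>
  from this[of "F (a + h) - G h"] have "F (a + h) = G h" by simp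
  then show ?thesis using G[OF h] by simp
qed

section \<open>Estimates for the Newton step\<close>

lemma directional_derivative_limit:
  assumes "(F has_derivative D) (at x)"
  shows "((\<lambda>s. (F (x + s *\<^sub>R v) - F x) /\<^sub>R s) \<longlongrightarrow> D v) (at 0)"
proof -
  have lin: "linear D" using assms has_derivative_linear by blast
  have "((\<lambda>s. F (x + s *\<^sub>R v)) has_derivative (\<lambda>s. D (s *\<^sub>R v))) (at 0)"
    by (rule has_derivative_compose[where g = F and g' = D]) (use assms in \<open>auto intro!: derivative_eq_intros\<close>)
  then have "((\<lambda>s. norm (F (x + s *\<^sub>R v) - F x - s *\<^sub>R D v) / norm s) \<longlongrightarrow> 0) (at 0)"
    by (simp add: has_derivative_at linear_scale[OF lin])
  moreover have "\<forall>\<^sub>F s in at 0. norm (F (x + s *\<^sub>R v) - F x - s *\<^sub>R D v) / norm s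
      = norm ((F (x + s *\<^sub>R v) - F x) /\<^sub>R s - D v)"
  proof -
    have "norm (F (x + s *\<^sub>R v) - F x - s *\<^sub>R D v) / norm s
      = norm ((F (x + s *\<^sub>R v) - F x) /\<^sub>R s - D v)" if "s \<noteq> 0" for s :: real
    proof -
      have "(F (x + s *\<^sub>R v) - F x) /\<^sub>R s - D v = (F (x + s *\<^sub>R v) - F x - s *\<^sub>R D v) /\<^sub>R s"
        using that by (simp add: scaleR_diff_right)
      then show ?thesis by (simp add: divide_inverse_commute)
    qed
    then show ?thesis by (simp add: eventually_at_filter)
  qed
  ultimately have "((\<lambda>s. norm ((F (x + s *\<^sub>R v) - F x) /\<^sub>R s - D v)) \<longlongrightarrow> 0) (at 0)"
    by (rule Lim_transform_eventually)
  then have "((\<lambda>s. (F (x + s *\<^sub>R v) - F x) /\<^sub>R s - D v) \<longlongrightarrow> 0) (at 0)"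
    by (rule tendsto_norm_zero_cancel)
  then show ?thesis by (simp add: Lim_null[symmetric])
qed

lemma norm_sums_le:
  fixes f :: "nat \<Rightarrow> 'a::banach"
  assumes f: "f sums s" and g: "g sums t" and le: "\<And>n. norm (f n) \<le> g n"
  shows "norm s \<le> t"
  using norm_suminf_le[OF le sums_summable[OF g]] sums_unique[OF f] sums_unique[OF g] by simp

lemma sums_drop_first:
  fixes f :: "nat \<Rightarrow> 'a::real_normed_vector"
  assumes "f sums s"
  shows "(\<lambda>n. if n = 0 then 0 else f n) sums (s - f 0)"
proof -
  have "(\<lambda>n. f n - (if n = 0 then f n else 0)) sums (s - f 0)"
    by (intro sums_diff assms sums_single)
  then show ?thesis by (rule back_subst[of "\<lambda>g. g sums (s - f 0)"]) auto
qed

lemma zero_in_elt_set_plus: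
  fixes u :: "'a::ab_group_add"
  shows "0 \<in> u +o S \<longleftrightarrow> - u \<in> S"
proof
  assume "0 \<in> u +o S"
  then obtain b where "b \<in> S" "u + b = 0" unfolding elt_set_plus_def by auto
  then show "- u \<in> S" by (metis add_eq_0_iff)
next
  assume "- u \<in> S"
  then show "0 \<in> u +o S" unfolding elt_set_plus_def by (auto intro: bexI[of _ "- u"])
qed

text \<open>Here \<open>a\<close> is the solution. The condition \<open>\<gamma> * R \<le> 1\<close>
  makes the geometric majorants converge on the open ball of radius \<open>R\<close>, and a nonzero
  vector makes \<open>\<beta>\<close> positive. The choice \<open>R = 0\<close>, with an empty ball,
  later serves to extract the sign of \<open>\<gamma>\<close>.\<close>

locale newton_setting =
  fixes \<Omega> :: "'a::{real_inner, banach} set" and F :: "'a \<Rightarrow> 'a" and T :: "'a \<Rightarrow> 'a set"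
    and a :: 'a and \<gamma> R :: real
  assumes problem: "newton_problem \<Omega> F T a \<gamma>" and R: "ball a R \<subseteq> \<Omega>" "\<gamma> * R \<le> 1"
    and nontrivial: "\<exists>v::'a. v \<noteq> 0"
begin

abbreviation "D x \<equiv> frechet_derivative F (at x)"

definition "\<beta> = onorm (inv (sym_part (D a)))"

definition "taylor_norm n = multilinear_norm n (\<lambda>vs. nth_frechet n F a vs /\<^sub>R fact n)"

lemma analytic: "analytic_map_on F \<Omega>" and maximal: "maximal_monotone_operator T"
  and monotone: "monotone_operator T" and a_in: "a \<in> \<Omega>" and zero: "- F a \<in> T a"
  and positive: "positive_operator (D a)" and invertible: "invertible_operator (sym_part (D a))"
  and gamma: "newton_gamma F a = ereal \<gamma>"
  using problem
  by (auto simp: newton_problem_def maximal_monotone_operator_def zero_in_elt_set_plus)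

lemma has_derivative: "x \<in> \<Omega> \<Longrightarrow> (F has_derivative D x) (at x)"
  using analytic smooth_map_has_derivative unfolding analytic_map_on_def by blast

lemma linear_D: "x \<in> \<Omega> \<Longrightarrow> linear (D x)" and bounded_linear_D: "x \<in> \<Omega> \<Longrightarrow> bounded_linear (D x)"
  using has_derivative has_derivative_linear has_derivative_bounded_linear by blast+

lemma multilinear: "bounded_multilinear n (nth_frechet n F a)"
  using analytic a_in unfolding analytic_map_on_def smooth_map_on_def by blast

lemma multilinear_taylor: "bounded_multilinear n (\<lambda>vs. nth_frechet n F a vs /\<^sub>R fact n)"
  by (rule bounded_multilinear_scaleR[OF multilinear])

lemma taylor_norm_nonneg: "0 \<le> taylor_norm n"
  unfolding taylor_norm_def by (rule multilinear_norm_nonneg[OF multilinear_taylor])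

lemma beta_nonneg: "0 \<le> \<beta>"
  using invertible onorm_pos_le unfolding \<beta>_def invertible_operator_def by blast

text \<open>A Cauchy-Schwarz argument for the positive form of \<open>D a\<close>: it is evaluated
  at \<open>u - \<beta> v\<close>, where \<open>u\<close> is the preimage of \<open>v\<close>, and
  \<open>v \<bullet> u\<close> is at most \<open>\<beta>\<close> times the square of
  \<open>norm v\<close>.\<close>

lemma coercive_at_solution: "(norm v)\<^sup>2 \<le> \<beta> * (D a v \<bullet> v)" and beta_pos: "0 < \<beta>"
proof -
  have sym: "D a x \<bullet> y = x \<bullet> D a y" and pos: "0 \<le> D a x \<bullet> x" for x y
    using positive unfolding positive_operator_def by blast+
  have "adjoint (D a) = D a" by (rule adjoint_unique) (use sym in blast)
  then have sp: "sym_part (D a) = D a" by (simp add: sym_part_def fun_eq_iff flip: scaleR_2)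
  have bij: "bij (D a)" and bl: "bounded_linear (inv (D a))"
    using invertible unfolding sp invertible_operator_def by blast+
  have inv_le: "norm (inv (D a) v) \<le> \<beta> * norm v" for v
    unfolding \<beta>_def sp by (rule onorm[OF bl])
  have D_inv: "D a (inv (D a) v) = v" for v using bij by (simp add: bij_is_surj surj_f_inv_f)
  show b: "0 < \<beta>"
  proof (rule ccontr)
    assume "\<not> 0 < \<beta>"
    then have b0: "\<beta> = 0" using beta_nonneg by simp
    have z: "inv (D a) v = 0" for v using inv_le[of v] by (simp add: b0)
    have "D a 0 = v" for v using D_inv[of v] by (simp add: z)
    then show False using nontrivial by metis
  qed
  show "(norm v)\<^sup>2 \<le> \<beta> * (D a v \<bullet> v)" for v
  proof -
    define u where "u = inv (D a) v"
    have u: "D a u = v" by (simp add: u_def D_inv)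
    have "0 \<le> D a (u - \<beta> *\<^sub>R v) \<bullet> (u - \<beta> *\<^sub>R v)" by (rule pos)
    also have "\<dots> = v \<bullet> u - 2 * \<beta> * (v \<bullet> v) + \<beta> * (\<beta> * (D a v \<bullet> v))"
      using sym[of v u]
      by (simp add: linear_diff[OF linear_D[OF a_in]] linear_scale[OF linear_D[OF a_in]] u
          inner_diff_left inner_diff_right inner_commute algebra_simps)
    also have "v \<bullet> u \<le> norm v * (\<beta> * norm v)"
      using norm_cauchy_schwarz[of v u] mult_left_mono[OF inv_le, of "norm v" v] u_def by simp
    finally have "\<beta> * (norm v)\<^sup>2 \<le> \<beta> * (\<beta> * (D a v \<bullet> v))"
      by (simp add: power2_norm_eq_inner[symmetric] power2_eq_square algebra_simps)
    then show ?thesis using b by simp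
  qed
qed

text \<open>The case split follows \<open>newton_gamma\<close>. With \<open>\<beta>\<close> under
  the root, taking powers gives the claim at once; with \<open>\<beta>\<close> outside, the power is
  \<open>\<beta> ^ Suc n\<close>, which dominates \<open>\<beta>\<close> because then
  \<open>1 \<le> \<beta>\<close>. The derivative has order \<open>n + 2\<close>, the root order
  \<open>n + 1\<close>.\<close>

lemma gamma_nonneg: "0 \<le> \<gamma>" and taylor_norm_bound: "\<beta> * taylor_norm (Suc (Suc n)) \<le> \<gamma> ^ Suc n"
proof -
  have g: "ereal \<gamma> = (if 1 \<le> \<beta> then ereal \<beta> * (SUP n\<in>{2..}. ereal (root (n - 1) (taylor_norm n)))
        else (SUP n\<in>{2..}. ereal (root (n - 1) (\<beta> * taylor_norm n))))"
    using gamma unfolding newton_gamma_def Let_def \<beta>_def[symmetric] taylor_norm_def[symmetric] by simp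
  have le: "(if 1 \<le> \<beta> then \<beta> * root (Suc n) (taylor_norm (Suc (Suc n)))
      else root (Suc n) (\<beta> * taylor_norm (Suc (Suc n)))) \<le> \<gamma>" (is "?l n \<le> \<gamma>") for n
  proof (cases "1 \<le> \<beta>")
    case True
    have "ereal (root (Suc (Suc n) - 1) (taylor_norm (Suc (Suc n)))) \<le> (SUP n\<in>{2..}. ereal (root (n - 1) (taylor_norm n)))"
      by (rule SUP_upper) simp
    then have "ereal \<beta> * ereal (root (Suc n) (taylor_norm (Suc (Suc n)))) \<le> ereal \<gamma>"
      unfolding g using True beta_nonneg by (simp add: ereal_mult_left_mono del: times_ereal.simps)
    then show ?thesis using True by simp
  next
    case False
    have "ereal (root (Suc (Suc n) - 1) (\<beta> * taylor_norm (Suc (Suc n)))) \<le> (SUP n\<in>{2..}. ereal (root (n - 1) (\<beta> * taylor_norm n)))"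
      by (rule SUP_upper) simp
    also have "\<dots> = ereal \<gamma>" using False g by simp
    finally show ?thesis using False by simp
  qed
  have nonneg: "0 \<le> ?l n" for n
    using beta_nonneg taylor_norm_nonneg[of "Suc (Suc n)"] by (simp add: real_root_ge_zero)
  then show "0 \<le> \<gamma>" using le[of 0] order_trans by blast
  have "?l n ^ Suc n \<le> \<gamma> ^ Suc n" using le nonneg by (rule power_mono)
  moreover have "\<beta> * taylor_norm (Suc (Suc n)) \<le> ?l n ^ Suc n"
  proof (cases "1 \<le> \<beta>")
    case True
    have "\<beta> ^ 1 \<le> \<beta> ^ Suc n" by (rule power_increasing) (use True in auto)
    then have "\<beta> * taylor_norm (Suc (Suc n)) \<le> \<beta> ^ Suc n * taylor_norm (Suc (Suc n))"
      using taylor_norm_nonneg by (intro mult_right_mono) auto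
    also have "\<dots> = (\<beta> * root (Suc n) (taylor_norm (Suc (Suc n)))) ^ Suc n"
      unfolding power_mult_distrib using taylor_norm_nonneg by (subst real_root_pow_pos2) auto
    finally show ?thesis using True by simp
  next
    case False
    have "root (Suc n) (\<beta> * taylor_norm (Suc (Suc n))) ^ Suc n = \<beta> * taylor_norm (Suc (Suc n))"
      using taylor_norm_nonneg beta_nonneg by (intro real_root_pow_pos2) auto
    then show ?thesis using False by simp
  qed
  ultimately show "\<beta> * taylor_norm (Suc (Suc n)) \<le> \<gamma> ^ Suc n" by linarith
qed

lemma gamma_mult_less_one:
  assumes "M < R" shows "\<gamma> * M < 1"
proof (cases "\<gamma> = 0")
  case False
  then have "\<gamma> * M < \<gamma> * R" using gamma_nonneg assms by (intro mult_strict_left_mono) auto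
  then show ?thesis using R(2) by linarith
qed simp

section \<open>Geometric majorants for the Taylor series at the solution\<close>

abbreviation "P \<equiv> taylor_term F a"

lemma P_scale: "P n (s *\<^sub>R h) = s ^ n *\<^sub>R P n h"
  by (simp add: multilinear_scale_replicate[OF multilinear])

lemma P_diff_bound:
  assumes "norm h \<le> M" "norm k \<le> M"
  shows "\<beta> * norm (P (Suc (Suc n)) h - P (Suc (Suc n)) k) \<le> real (Suc (Suc n)) * (\<gamma> * M) ^ Suc n * norm (h - k)"
proof -
  have M: "0 \<le> M" using assms(1) norm_ge_zero order_trans by blast
  have "norm (P (Suc (Suc n)) h - P (Suc (Suc n)) k)
      \<le> real (Suc (Suc n)) * (taylor_norm (Suc (Suc n)) * M ^ (Suc (Suc n) - 1)) * norm (h - k)"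
    unfolding taylor_norm_def using multilinear_diagonal_diff[OF multilinear_taylor assms] by blast
  from mult_left_mono[OF this beta_nonneg]
  have "\<beta> * norm (P (Suc (Suc n)) h - P (Suc (Suc n)) k)
      \<le> (\<beta> * taylor_norm (Suc (Suc n))) * (real (Suc (Suc n)) * M ^ Suc n * norm (h - k))"
    by (simp add: mult_ac)
  also have "\<dots> \<le> \<gamma> ^ Suc n * (real (Suc (Suc n)) * M ^ Suc n * norm (h - k))"
    using M by (intro mult_right_mono taylor_norm_bound) auto
  finally show ?thesis by (simp add: power_mult_distrib mult_ac)
qed

lemma P_bound: "\<beta> * norm (P (Suc (Suc n)) h) \<le> (\<gamma> * norm h) ^ Suc n * norm h"
proof -
  have "norm (P (Suc (Suc n)) h) \<le> taylor_norm (Suc (Suc n)) * norm h ^ Suc (Suc n)"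
    using multilinear_norm_bound[OF multilinear_taylor, of "replicate (Suc (Suc n)) h" "Suc (Suc n)"]
    unfolding taylor_norm_def by (simp add: prod_list_replicate)
  from mult_left_mono[OF this beta_nonneg]
  have "\<beta> * norm (P (Suc (Suc n)) h) \<le> (\<beta> * taylor_norm (Suc (Suc n))) * norm h ^ Suc (Suc n)"
    by (simp add: mult_ac)
  also have "\<dots> \<le> \<gamma> ^ Suc n * norm h ^ Suc (Suc n)"
    by (intro mult_right_mono taylor_norm_bound) auto
  finally show ?thesis by (simp add: power_mult_distrib mult_ac)
qed

lemma taylor_sums:
  assumes h: "norm h < R"
  shows "(\<lambda>n. P n h) sums F (a + h)"
proof (rule analytic_map_taylor_sums[OF analytic R(1) _ h])
  fix k :: 'a assume k: "norm k < R"
  have "summable (\<lambda>n. P (Suc (Suc n)) k)"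
  proof (rule summable_comparison_test')
    have "norm (\<gamma> * norm k) < 1" using gamma_mult_less_one[OF k] gamma_nonneg by simp
    from summable_mult[OF summable_geometric[OF this]]
    show "summable (\<lambda>n. (\<gamma> * norm k * norm k / \<beta>) * (\<gamma> * norm k) ^ n)" .
    show "norm (P (Suc (Suc n)) k) \<le> (\<gamma> * norm k * norm k / \<beta>) * (\<gamma> * norm k) ^ n" if "0 \<le> n" for n
      using P_bound[of n k] beta_pos by (simp add: pos_le_divide_eq mult_ac)
  qed
  then have "summable (\<lambda>n. P (Suc n) k)" by (subst (asm) summable_Suc_iff)
  then show "summable (\<lambda>n. P n k)" by (subst (asm) summable_Suc_iff)
qed

lemma geometric_deriv_drop:
  assumes "\<bar>u\<bar> < (1::real)"
  shows "(\<lambda>n. if n = 0 then 0 else real (Suc n) * u ^ n) sums (1 / (1 - u)\<^sup>2 - 1)"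
  using sums_drop_first[OF geometric_deriv_sums[of u]] assms by simp

text \<open>In the difference of the two Taylor series the constant terms cancel and the linear
  terms give \<open>D a k\<close>. The tail is dominated by \<open>P_diff_bound\<close>, summed by
  \<open>geometric_deriv_drop\<close>.\<close>

lemma increment_bound:
  assumes h: "norm h < R" and M: "norm h \<le> M" "norm (h + k) \<le> M" "M < R"
  shows "\<beta> * norm (F (a + (h + k)) - F (a + h) - D a k) \<le> norm k * (1 / (1 - \<gamma> * M)\<^sup>2 - 1)"
proof -
  have M0: "0 \<le> M" using M(1) norm_ge_zero order_trans by blast
  have hk: "norm (h + k) < R" using M by linarith
  define d where "d n = P (Suc n) (h + k) - P (Suc n) h" for n
  have "(\<lambda>n. P n (h + k) - P n h) sums (F (a + (h + k)) - F (a + h))"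
    by (intro sums_diff taylor_sums h hk)
  then have "d sums (F (a + (h + k)) - F (a + h))"
    unfolding d_def by (subst sums_Suc_iff) simp
  from sums_scaleR_right[OF sums_drop_first[OF this], of \<beta>]
  have s: "(\<lambda>n. \<beta> *\<^sub>R (if n = 0 then 0 else d n)) sums (\<beta> *\<^sub>R (F (a + (h + k)) - F (a + h) - D a k))"
    by (simp add: d_def linear_add[OF linear_D[OF a_in]])
  have "\<bar>\<gamma> * M\<bar> < 1" using gamma_mult_less_one[OF M(3)] gamma_nonneg M0 by simp
  note g = sums_mult[OF geometric_deriv_drop[OF this], of "norm k"]
  \<comment> \<open>For \<open>n > 0\<close> the entry \<open>d n\<close> has order
    \<open>n + 1\<close>, which is the order in \<open>P_diff_bound\<close> at index
    \<open>n - 1\<close>.\<close>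
  have "norm (\<beta> *\<^sub>R (if n = 0 then 0 else d n))
      \<le> norm k * (if n = 0 then 0 else real (Suc n) * (\<gamma> * M) ^ n)" for n
    using P_diff_bound[OF M(2,1), of "n - 1"] beta_nonneg by (cases n) (auto simp: d_def mult_ac)
  from norm_sums_le[OF s g this] show ?thesis using beta_nonneg by simp
qed

text \<open>Apply \<open>increment_bound\<close> to the increment \<open>s v\<close> with
  \<open>M = norm h + s * norm v\<close>, divide by \<open>s\<close> and let \<open>s\<close> tend
  to 0 from the right.\<close>

lemma derivative_bound:
  assumes h: "norm h < R"
  shows "\<beta> * norm (D (a + h) v - D a v) \<le> norm v * (1 / (1 - \<gamma> * norm h)\<^sup>2 - 1)"
proof -
  have x: "a + h \<in> \<Omega>" using h R(1) by (auto simp: dist_norm)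
  have lim: "((\<lambda>s. \<beta> * norm ((F (a + h + s *\<^sub>R v) - F (a + h)) /\<^sub>R s - D a v)) \<longlongrightarrow>
      \<beta> * norm (D (a + h) v - D a v)) (at_right 0)"
    by (intro tendsto_mult tendsto_const tendsto_norm tendsto_diff
        tendsto_mono[OF _ directional_derivative_limit[OF has_derivative[OF x]]])
      (simp add: at_within_le_at)
  have "1 - \<gamma> * norm h \<noteq> 0" using gamma_mult_less_one[OF h] by simp
  then have "((\<lambda>s. norm v * (1 / (1 - \<gamma> * (norm h + s * norm v))\<^sup>2 - 1)) \<longlongrightarrow>
      norm v * (1 / (1 - \<gamma> * (norm h + 0 * norm v))\<^sup>2 - 1)) (at_right 0)"
    by (intro tendsto_intros) auto
  then have lim': "((\<lambda>s. norm v * (1 / (1 - \<gamma> * (norm h + s * norm v))\<^sup>2 - 1)) \<longlongrightarrow>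
      norm v * (1 / (1 - \<gamma> * norm h)\<^sup>2 - 1)) (at_right 0)" by simp
  have "((\<lambda>s. norm h + s * norm v) \<longlongrightarrow> norm h + 0 * norm v) (at_right 0)" by (intro tendsto_intros)
  then have "\<forall>\<^sub>F s in at_right 0. norm h + s * norm v < R" using h by (auto dest: order_tendstoD)
  with eventually_at_right_less[of "0::real"]
  have "\<forall>\<^sub>F s in at_right 0. \<beta> * norm ((F (a + h + s *\<^sub>R v) - F (a + h)) /\<^sub>R s - D a v)
      \<le> norm v * (1 / (1 - \<gamma> * (norm h + s * norm v))\<^sup>2 - 1)"
  proof eventually_elim
    case (elim s)
    have "norm (h + s *\<^sub>R v) \<le> norm h + s * norm v"
      using norm_triangle_ineq[of h "s *\<^sub>R v"] elim by simp
    then have "\<beta> * norm (F (a + (h + s *\<^sub>R v)) - F (a + h) - D a (s *\<^sub>R v))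
        \<le> norm (s *\<^sub>R v) * (1 / (1 - \<gamma> * (norm h + s * norm v))\<^sup>2 - 1)"
      using elim h by (intro increment_bound) auto
    also have "F (a + (h + s *\<^sub>R v)) - F (a + h) - D a (s *\<^sub>R v)
        = s *\<^sub>R ((F (a + h + s *\<^sub>R v) - F (a + h)) /\<^sub>R s - D a v)"
      using elim by (simp add: linear_scale[OF linear_D[OF a_in]] scaleR_diff_right add.assoc)
    finally have "s * (\<beta> * norm ((F (a + h + s *\<^sub>R v) - F (a + h)) /\<^sub>R s - D a v))
        \<le> s * (norm v * (1 / (1 - \<gamma> * (norm h + s * norm v))\<^sup>2 - 1))"
      using elim by (simp add: mult_ac)
    then show ?case using elim by simp
  qed
  then show ?thesis by (intro tendsto_le[OF _ lim' lim]) auto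
qed

text \<open>A perturbation of \<open>coercive_at_solution\<close>: replacing \<open>D a\<close> by
  \<open>D (a + h)\<close> lowers the constant 1 by at most the bound of
  \<open>derivative_bound\<close>.\<close>

lemma coercive:
  assumes h: "norm h < R"
  shows "(2 - 1 / (1 - \<gamma> * norm h)\<^sup>2) * (norm v)\<^sup>2 \<le> \<beta> * (D (a + h) v \<bullet> v)"
proof -
  have "- ((D (a + h) v - D a v) \<bullet> v) \<le> norm (D (a + h) v - D a v) * norm v"
    using norm_cauchy_schwarz[of "- (D (a + h) v - D a v)" v]
    unfolding norm_minus_cancel inner_minus_left .
  from mult_left_mono[OF this beta_nonneg]
  have "- (\<beta> * ((D (a + h) v - D a v) \<bullet> v)) \<le> (\<beta> * norm (D (a + h) v - D a v)) * norm v"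
    by (simp add: mult_ac)
  also have "\<dots> \<le> (norm v * (1 / (1 - \<gamma> * norm h)\<^sup>2 - 1)) * norm v"
    by (intro mult_right_mono derivative_bound h) simp
  finally show ?thesis
    using coercive_at_solution[of v] by (simp add: inner_diff_left power2_eq_square algebra_simps)
qed

text \<open>For \<open>0 < s < 1\<close> the difference quotient \<open>(1 - (1 - s)\<^sup>n) / s\<close> lies between \<open>1\<close> and \<open>n\<close>,
  so that no termwise differentiation of the series is needed.\<close>

lemma newton_residual_bound:
  assumes h: "norm h < R"
  shows "\<beta> * norm (D (a + h) h - (F (a + h) - F a)) \<le> \<gamma> * (norm h)\<^sup>2 / (1 - \<gamma> * norm h)\<^sup>2"
proof -
  have x: "a + h \<in> \<Omega>" using h R(1) by (auto simp: dist_norm)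
  let ?B = "\<gamma> * (norm h)\<^sup>2 / (1 - \<gamma> * norm h)\<^sup>2"
  have "((\<lambda>s. - ((F (a + h + s *\<^sub>R (- h)) - F (a + h)) /\<^sub>R s)) \<longlongrightarrow> - D (a + h) (- h)) (at_right 0)"
    by (intro tendsto_minus tendsto_mono[OF _ directional_derivative_limit[OF has_derivative[OF x]]])
      (simp add: at_within_le_at)
  then have "((\<lambda>s. \<beta> * norm (- ((F (a + h + s *\<^sub>R (- h)) - F (a + h)) /\<^sub>R s) - (F (a + h) - F a))) \<longlongrightarrow>
      \<beta> * norm (- D (a + h) (- h) - (F (a + h) - F a))) (at_right 0)"
    by (intro tendsto_mult tendsto_const tendsto_norm tendsto_diff)
  then have lim: "((\<lambda>s. \<beta> * norm (- ((F (a + h + s *\<^sub>R (- h)) - F (a + h)) /\<^sub>R s) - (F (a + h) - F a))) \<longlongrightarrow>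
      \<beta> * norm (D (a + h) h - (F (a + h) - F a))) (at_right 0)"
    by (simp add: linear_neg[OF linear_D[OF x]])
  have "\<forall>\<^sub>F s in at_right 0. \<beta> * norm (- ((F (a + h + s *\<^sub>R (- h)) - F (a + h)) /\<^sub>R s) - (F (a + h) - F a)) \<le> ?B"
    using eventually_at_right_real[OF zero_less_one]
  proof eventually_elim
    case (elim s)
    then have s: "0 < s" "s < 1" by auto
    \<comment> \<open>By homogeneity of \<open>P n\<close>, the difference quotient towards
      \<open>a\<close> minus the increment multiplies the Taylor term of order \<open>n\<close> by
      \<open>c n\<close>. For \<open>n > 0\<close> this factor lies between 0 and
      \<open>n - 1\<close>, the upper bound by Bernoulli's inequality.\<close>
    define c where "c n = (1 - (1 - s) ^ n) / s - 1" for n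
    have c: "0 \<le> c (Suc n)" "c (Suc n) \<le> real n" for n
    proof -
      have "(1 - s) ^ Suc n \<le> (1 - s) ^ 1" by (rule power_decreasing) (use s in auto)
      then show "0 \<le> c (Suc n)" using s by (simp add: c_def field_simps)
      have "1 + real (Suc n) * (- s) \<le> (1 + - s) ^ Suc n"
        by (rule Bernoulli_inequality) (use s in auto)
      then show "c (Suc n) \<le> real n" using s by (simp add: c_def field_simps)
    qed
    have sh: "norm ((1 - s) *\<^sub>R h) < R"
    proof -
      have "\<bar>1 - s\<bar> * norm h \<le> 1 * norm h" using s by (intro mult_right_mono) auto
      then show ?thesis using h by simp
    qed
    let ?q = "- ((F (a + h + s *\<^sub>R (- h)) - F (a + h)) /\<^sub>R s) - (F (a + h) - F a)"
    have "(\<lambda>n. (P n h - P n ((1 - s) *\<^sub>R h)) /\<^sub>R s - (if n = 0 then 0 else P n h)) sums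
        ((F (a + h) - F (a + (1 - s) *\<^sub>R h)) /\<^sub>R s - (F (a + h) - P 0 h))"
      by (intro sums_diff sums_scaleR_right sums_drop_first taylor_sums h sh)
    moreover have "(F (a + h) - F (a + (1 - s) *\<^sub>R h)) /\<^sub>R s - (F (a + h) - P 0 h) = ?q"
      by (simp add: scaleR_diff_left scaleR_diff_right algebra_simps)
    ultimately have "(\<lambda>n. (P (Suc n) h - P (Suc n) ((1 - s) *\<^sub>R h)) /\<^sub>R s
        - (if Suc n = 0 then 0 else P (Suc n) h)) sums ?q"
      by (subst sums_Suc_iff) simp
    then have "(\<lambda>n. (P (Suc n) h - P (Suc n) ((1 - s) *\<^sub>R h)) /\<^sub>R s - P (Suc n) h) sums ?q" by simp
    moreover have "(P (Suc n) h - P (Suc n) ((1 - s) *\<^sub>R h)) /\<^sub>R s - P (Suc n) h = c (Suc n) *\<^sub>R P (Suc n) h" for n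
      unfolding P_scale c_def by (simp add: divide_inverse algebra_simps)
    ultimately have "(\<lambda>n. c (Suc n) *\<^sub>R P (Suc n) h) sums ?q" by simp
    \<comment> \<open>The linear term drops out, so the series starts at order 2, where the bounds
      by powers of \<open>\<gamma>\<close> begin.\<close>
    moreover have "c (Suc 0) = 0" using s by (simp add: c_def)
    ultimately have "(\<lambda>n. c (Suc (Suc n)) *\<^sub>R P (Suc (Suc n)) h) sums ?q"
      by (subst sums_Suc_iff) simp
    from sums_scaleR_right[OF this, of \<beta>]
    have q: "(\<lambda>n. \<beta> *\<^sub>R c (Suc (Suc n)) *\<^sub>R P (Suc (Suc n)) h) sums (\<beta> *\<^sub>R ?q)" .
    have "norm (\<gamma> * norm h) < 1" using gamma_mult_less_one[OF h] gamma_nonneg by simp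
    note g = sums_mult[OF geometric_deriv_sums[OF this], of "\<gamma> * norm h * norm h"]
    have "norm (\<beta> *\<^sub>R c (Suc (Suc n)) *\<^sub>R P (Suc (Suc n)) h)
        \<le> \<gamma> * norm h * norm h * (of_nat (Suc n) * (\<gamma> * norm h) ^ n)" for n
    proof -
      have "norm (\<beta> *\<^sub>R c (Suc (Suc n)) *\<^sub>R P (Suc (Suc n)) h)
          = c (Suc (Suc n)) * (\<beta> * norm (P (Suc (Suc n)) h))"
        using c(1)[of "Suc n"] beta_nonneg by (simp add: mult_ac)
      also have "\<dots> \<le> real (Suc n) * ((\<gamma> * norm h) ^ Suc n * norm h)"
        using beta_nonneg gamma_nonneg by (intro mult_mono c P_bound) auto
      finally show ?thesis by (simp add: mult_ac)
    qed
    from norm_sums_le[OF q g this] show ?case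
      using beta_nonneg by (simp add: power2_eq_square mult_ac)
  qed
  then show ?thesis by (intro tendsto_upperbound[OF lim]) auto
qed

text \<open>Unlike the derivative, the Taylor remainder carries no factor \<open>n\<close>, so a
  plain geometric series majorizes it. The radius \<open>1 / (2 * \<gamma>)\<close> of uniqueness
  comes from here.\<close>

lemma linearization_bound:
  assumes h: "norm h < R"
  shows "\<beta> * norm (F (a + h) - F a - D a h) \<le> norm h * (\<gamma> * norm h / (1 - \<gamma> * norm h))"
proof -
  have "(\<lambda>n. P (Suc n) h) sums (F (a + h) - F a)"
    using taylor_sums[OF h] by (subst sums_Suc_iff) simp
  then have "(\<lambda>n. P (Suc (Suc n)) h) sums (F (a + h) - F a - D a h)"
    by (subst sums_Suc_iff) simp
  from sums_scaleR_right[OF this, of \<beta>]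
  have q: "(\<lambda>n. \<beta> *\<^sub>R P (Suc (Suc n)) h) sums (\<beta> *\<^sub>R (F (a + h) - F a - D a h))" .
  have "norm (\<gamma> * norm h) < 1" using gamma_mult_less_one[OF h] gamma_nonneg by simp
  note g = sums_mult[OF geometric_sums[OF this], of "norm h * (\<gamma> * norm h)"]
  have "norm (\<beta> *\<^sub>R P (Suc (Suc n)) h) \<le> norm h * (\<gamma> * norm h) * (\<gamma> * norm h) ^ n" for n
    using P_bound[of n h] beta_nonneg by (simp add: mult_ac)
  from norm_sums_le[OF q g this] show ?thesis using beta_nonneg by simp
qed

section \<open>A single Newton step and uniqueness of the solution\<close>

lemma newton_step_iff:
  assumes "x \<in> \<Omega>"
  shows "newton_step F T x y \<longleftrightarrow> (D x x - F x) - D x y \<in> T y"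
proof -
  have "newton_step F T x y \<longleftrightarrow> - (F x + D x (y - x)) \<in> T y"
    unfolding newton_step_def by (rule zero_in_elt_set_plus)
  then show ?thesis by (simp add: linear_diff[OF linear_D[OF assms]] algebra_simps)
qed

lemma newton_step_exists:
  assumes h: "norm h < R" and u: "1 < 2 * (1 - \<gamma> * norm h)\<^sup>2"
  shows "\<exists>!y. newton_step F T (a + h) y"
proof -
  have x: "a + h \<in> \<Omega>" using h R(1) by (auto simp: dist_norm)
  have "0 < (1 - \<gamma> * norm h)\<^sup>2" using gamma_mult_less_one[OF h] by simp
  \<comment> \<open>The hypothesis \<open>u\<close> says precisely that the constant in
    \<open>coercive\<close> is positive, so that \<open>D (a + h)\<close> is strongly
    monotone.\<close>
  then have c: "0 < (2 - 1 / (1 - \<gamma> * norm h)\<^sup>2) / \<beta>" using u beta_pos by (simp add: field_simps)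
  show ?thesis
    unfolding newton_step_iff[OF x]
  proof (rule strongly_monotone_solvable[OF maximal c bounded_linear_D[OF x]])
    show "(2 - 1 / (1 - \<gamma> * norm h)\<^sup>2) / \<beta> * (norm v)\<^sup>2 \<le> D (a + h) v \<bullet> v" for v
      using coercive[OF h, of v] beta_pos by (simp add: pos_divide_le_eq mult_ac)
  qed
qed

lemma newton_step_bound:
  assumes h: "norm h < R" and u: "1 < 2 * (1 - \<gamma> * norm h)\<^sup>2" and y: "newton_step F T (a + h) y"
  shows "norm (y - a) \<le> \<gamma> / (2 * (1 - \<gamma> * norm h)\<^sup>2 - 1) * (norm h)\<^sup>2"
proof (cases "y = a")
  case True
  then show ?thesis using u gamma_nonneg by simp
next
  case False
  have x: "a + h \<in> \<Omega>" using h R(1) by (auto simp: dist_norm)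
  define w where "w = y - a"
  let ?r = "D (a + h) h - (F (a + h) - F a)"
  have nz: "0 < (1 - \<gamma> * norm h)\<^sup>2" using gamma_mult_less_one[OF h] by simp
  \<comment> \<open>\<open>T\<close> is tested at \<open>y\<close>, with the value supplied by the
    step, and at \<open>a\<close>, with the value \<open>- F a\<close>. The difference of the values
    is the residual \<open>?r\<close> minus \<open>D (a + h) w\<close>.\<close>
  have "0 \<le> ((D (a + h) (a + h) - F (a + h)) - D (a + h) y - (- F a)) \<bullet> (y - a)"
    by (rule monotoneD[OF monotone _ zero]) (use y in \<open>simp add: newton_step_iff[OF x]\<close>)
  also have "(D (a + h) (a + h) - F (a + h)) - D (a + h) y - (- F a) = ?r - D (a + h) w"
    by (simp add: w_def linear_diff[OF linear_D[OF x]] linear_add[OF linear_D[OF x]])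
  finally have "D (a + h) w \<bullet> w \<le> ?r \<bullet> w" by (simp add: w_def inner_diff_left)
  also have "\<dots> \<le> norm ?r * norm w" by (rule norm_cauchy_schwarz)
  finally have "\<beta> * (D (a + h) w \<bullet> w) \<le> \<beta> * (norm ?r * norm w)"
    using beta_nonneg by (rule mult_left_mono)
  also have "\<dots> = (\<beta> * norm ?r) * norm w" by simp
  also have "\<dots> \<le> (\<gamma> * (norm h)\<^sup>2 / (1 - \<gamma> * norm h)\<^sup>2) * norm w"
    by (intro mult_right_mono newton_residual_bound h) simp
  finally have "(2 - 1 / (1 - \<gamma> * norm h)\<^sup>2) * (norm w)\<^sup>2 \<le> (\<gamma> * (norm h)\<^sup>2 / (1 - \<gamma> * norm h)\<^sup>2) * norm w"
    using coercive[OF h, of w] by linarith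
  then have "(2 - 1 / (1 - \<gamma> * norm h)\<^sup>2) * norm w \<le> \<gamma> * (norm h)\<^sup>2 / (1 - \<gamma> * norm h)\<^sup>2"
    using False unfolding power2_eq_square[of "norm w"] mult.assoc[symmetric]
    by (subst (asm) mult_le_cancel_right) (simp add: w_def)
  \<comment> \<open>Clearing the square of \<open>1 - \<gamma> * norm h\<close> turns the coercivity
    constant into the denominator of the claim.\<close>
  from mult_right_mono[OF this less_imp_le[OF nz]]
  have "(1 - \<gamma> * norm h)\<^sup>2 * (2 - 1 / (1 - \<gamma> * norm h)\<^sup>2) * norm w \<le> \<gamma> * (norm h)\<^sup>2"
    using nz by (simp add: mult_ac)
  moreover have "(1 - \<gamma> * norm h)\<^sup>2 * (2 - 1 / (1 - \<gamma> * norm h)\<^sup>2) = 2 * (1 - \<gamma> * norm h)\<^sup>2 - 1"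
    using nz by (simp add: right_diff_distrib)
  ultimately have "(2 * (1 - \<gamma> * norm h)\<^sup>2 - 1) * norm w \<le> \<gamma> * (norm h)\<^sup>2"
    by simp
  then show ?thesis using u by (simp add: w_def pos_le_divide_eq mult_ac)
qed

text \<open>Monotonicity of \<open>T\<close> makes \<open>(F (a + h) - F a) \<bullet> h\<close>
  nonpositive. For \<open>h \<noteq> 0\<close>, coercivity at \<open>a\<close> and
  \<open>linearization_bound\<close> make it positive if \<open>u / (1 - u) < 1\<close> for
  \<open>u = \<gamma> * norm h\<close>, that is, if \<open>u < 1 / 2\<close>.\<close>

lemma solution_unique:
  assumes h: "norm h < R" and u: "\<gamma> * norm h < 1 / 2" and s: "0 \<in> F (a + h) +o T (a + h)"
  shows "h = 0"
proof (rule ccontr)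
  assume h0: "h \<noteq> 0"
  have "- F (a + h) \<in> T (a + h)"
    using s by (simp add: zero_in_elt_set_plus)
  from monotoneD[OF monotone this zero] have "(F (a + h) - F a) \<bullet> h \<le> 0" by (simp add: inner_diff_left)
  then have "D a h \<bullet> h \<le> - ((F (a + h) - F a - D a h) \<bullet> h)" by (simp add: inner_diff_left)
  also have "\<dots> \<le> norm (F (a + h) - F a - D a h) * norm h"
    using norm_cauchy_schwarz[of "- (F (a + h) - F a - D a h)" h]
    unfolding norm_minus_cancel inner_minus_left .
  finally have "\<beta> * (D a h \<bullet> h) \<le> \<beta> * (norm (F (a + h) - F a - D a h) * norm h)"
    using beta_nonneg by (rule mult_left_mono)
  also have "\<dots> \<le> norm h * (\<gamma> * norm h / (1 - \<gamma> * norm h)) * norm h"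
    using mult_right_mono[OF linearization_bound[OF h], of "norm h"] by (simp add: mult_ac)
  finally have "1 * (norm h)\<^sup>2 \<le> (\<gamma> * norm h / (1 - \<gamma> * norm h)) * (norm h)\<^sup>2"
    using coercive_at_solution[of h] by (simp add: power2_eq_square mult_ac)
  then have "1 \<le> \<gamma> * norm h / (1 - \<gamma> * norm h)" using h0 by (subst (asm) mult_le_cancel_right) auto
  then show False using u by (simp add: pos_le_divide_eq)
qed

end

section \<open>Majorant sequence and convergence\<close>

text \<open>The difference of the two sides is \<open>2 * u\<^sup>2 - 5 * u + 1\<close>, whose roots
  are \<open>(5 - sqrt 17) / 4\<close> and \<open>(5 + sqrt 17) / 4\<close>.\<close>

lemma newton_denominator_gt:
  fixes u :: real
  assumes "u < (5 - sqrt 17) / 4"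
  shows "u < 2 * (1 - u)\<^sup>2 - 1"
proof -
  have s: "sqrt 17 * sqrt 17 = 17" "0 \<le> sqrt 17" by simp_all
  have "0 < ((5 - sqrt 17) / 4 - u) * ((5 + sqrt 17) / 4 - u)"
  proof (intro mult_pos_pos)
    have "5 - sqrt 17 \<le> 5 + sqrt 17" using s(2) by simp
    then show "0 < (5 + sqrt 17) / 4 - u" using assms by argo
  qed (use assms in simp)
  also have "\<dots> = (2 * (1 - u)\<^sup>2 - 1 - u) / 2"
    using s(1) by (simp add: power2_eq_square field_simps)
  finally show ?thesis by simp
qed

lemma radius_constant_bounds: "0 < 5 - sqrt 17" "(5 - sqrt 17) / 4 < 1 / 4"
proof -
  show "0 < 5 - sqrt 17" using real_sqrt_less_mono[of 17 25] by simp
  have "4 < sqrt 17" using real_sqrt_less_mono[of 16 17] by simp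
  then show "(5 - sqrt 17) / 4 < 1 / 4" by simp
qed

locale newton_majorant =
  fixes \<gamma> t0 :: real
  assumes gamma_nonneg: "0 \<le> \<gamma>" and t0_nonneg: "0 \<le> t0" and small: "\<gamma> * t0 < (5 - sqrt 17) / 4"
begin

abbreviation "t \<equiv> scalar_sequence \<gamma> t0"

definition "factor s = \<gamma> / (2 * (1 - \<gamma> * s)\<^sup>2 - 1)"

lemma denominator_pos:
  assumes "0 \<le> s" "s \<le> t0" shows "0 < 2 * (1 - \<gamma> * s)\<^sup>2 - 1"
proof -
  have "0 \<le> \<gamma> * s" "\<gamma> * s \<le> \<gamma> * t0" using assms gamma_nonneg by (auto intro: mult_left_mono)
  then show ?thesis using newton_denominator_gt[of "\<gamma> * s"] small by linarith
qed

lemma factor_nonneg: "0 \<le> s \<Longrightarrow> s \<le> t0 \<Longrightarrow> 0 \<le> factor s"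
  unfolding factor_def using denominator_pos[of s] gamma_nonneg by simp

lemma denominator_strict_mono:
  assumes "0 < \<gamma>" "0 \<le> s" "s < s'" "s' \<le> t0"
  shows "2 * (1 - \<gamma> * s')\<^sup>2 - 1 < 2 * (1 - \<gamma> * s)\<^sup>2 - 1"
proof -
  have "\<gamma> * s < \<gamma> * s'" "\<gamma> * s' \<le> \<gamma> * t0" using assms by auto
  then have "1 - \<gamma> * s' < 1 - \<gamma> * s" "0 \<le> 1 - \<gamma> * s'"
    using small radius_constant_bounds(2) by linarith+
  then show ?thesis by (simp add: power_strict_mono)
qed

lemma factor_strict_mono:
  assumes "0 < \<gamma>" "0 \<le> s" "s < s'" "s' \<le> t0"
  shows "factor s < factor s'"
  unfolding factor_def using denominator_strict_mono[OF assms] denominator_pos[of s'] assms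
  by (intro divide_strict_left_mono) auto

lemma factor_mono:
  assumes "0 \<le> s" "s \<le> s'" "s' \<le> t0" shows "factor s \<le> factor s'"
proof (cases "0 < \<gamma> \<and> s \<noteq> s'")
  case True
  then show ?thesis using factor_strict_mono[of s s'] assms by simp
next
  case False
  then show ?thesis using gamma_nonneg by (auto simp: factor_def)
qed

text \<open>The contraction factor of the first step. It bounds those of all later steps because
  \<open>factor\<close> is monotone, and it is below 1 by
  \<open>newton_denominator_gt\<close>.\<close>

definition "rate = factor t0 * t0"

lemma rate: "0 \<le> rate" "rate < 1"
proof -
  have "0 \<le> factor t0" using factor_nonneg t0_nonneg by simp
  then show "0 \<le> rate" unfolding rate_def using t0_nonneg by simp
  have "\<gamma> * t0 < 2 * (1 - \<gamma> * t0)\<^sup>2 - 1" by (rule newton_denominator_gt[OF small])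
  then show "rate < 1" unfolding rate_def factor_def using denominator_pos[of t0] t0_nonneg
    by (simp add: pos_divide_less_eq)
qed

lemma t_Suc: "t (Suc k) = factor (t k) * (t k)\<^sup>2"
  by (simp add: factor_def)

lemma step_le:
  assumes "0 \<le> s" "s \<le> t0" shows "factor s * s\<^sup>2 \<le> rate * s"
proof -
  have "factor s * s \<le> factor t0 * t0"
    using assms factor_mono[of s t0] factor_nonneg[of t0] t0_nonneg by (intro mult_mono) auto
  then show ?thesis using assms(1) unfolding rate_def power2_eq_square mult.assoc[symmetric]
    by (rule mult_right_mono)
qed

text \<open>The bound by \<open>t0\<close> is carried through the induction because
  \<open>step_le\<close> applies only below \<open>t0\<close>.\<close>

lemma t_bounds: "0 \<le> t k \<and> t k \<le> rate ^ k * t0 \<and> t k \<le> t0"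
proof (induction k)
  case 0
  then show ?case using t0_nonneg by simp
next
  case (Suc k)
  have 1: "t (Suc k) \<le> rate * t k" using Suc step_le t_Suc by metis
  also have "\<dots> \<le> rate * (rate ^ k * t0)" using Suc rate by (intro mult_left_mono) auto
  finally have "t (Suc k) \<le> rate ^ Suc k * t0" by simp
  moreover have "rate * t k \<le> 1 * t0" using Suc rate by (intro mult_mono) auto
  moreover have "0 \<le> t (Suc k)" unfolding t_Suc using Suc factor_nonneg[of "t k"] by simp
  ultimately show ?case using 1 by linarith
qed

lemma t_nonneg: "0 \<le> t k" and t_le: "t k \<le> t0"
  using t_bounds by blast+

lemma t_tendsto_0: "t \<longlonglongrightarrow> 0"
proof (rule tendsto_sandwich)
  show "\<forall>\<^sub>F k in sequentially. 0 \<le> t k" "\<forall>\<^sub>F k in sequentially. t k \<le> rate ^ k * t0"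
    using t_bounds by simp_all
  have "(\<lambda>k. rate ^ k * t0) \<longlonglongrightarrow> 0 * t0"
    by (intro tendsto_intros LIMSEQ_realpow_zero rate)
  then show "(\<lambda>k. rate ^ k * t0) \<longlonglongrightarrow> 0" by simp
qed simp

lemma t_pos:
  assumes "0 < \<gamma>" "0 < t0" shows "0 < t k"
proof (induction k)
  case (Suc k)
  have "0 < factor (t k)" unfolding factor_def using denominator_pos[of "t k"] t_nonneg t_le assms by simp
  then show ?case unfolding t_Suc using Suc by simp
qed (use assms in simp)

lemma t_strict_decreasing:
  assumes "0 < \<gamma>" "0 < t0" shows "t (Suc k) < t k"
proof -
  have "t (Suc k) \<le> rate * t k" unfolding t_Suc by (rule step_le[OF t_nonneg t_le])
  also have "\<dots> < 1 * t k" using t_pos[OF assms] rate by (intro mult_strict_right_mono) auto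
  finally show ?thesis by simp
qed

lemma t_quotient: "0 < \<gamma> \<Longrightarrow> 0 < t0 \<Longrightarrow> t (Suc k) / (t k)\<^sup>2 = factor (t k)"
  unfolding t_Suc using t_pos[of k] by simp

lemma t_quotient_decreasing:
  assumes "0 < \<gamma>" "0 < t0"
  shows "t (Suc (Suc k)) / (t (Suc k))\<^sup>2 < t (Suc k) / (t k)\<^sup>2"
  unfolding t_quotient[OF assms]
  by (rule factor_strict_mono[OF assms(1) t_nonneg t_strict_decreasing[OF assms] t_le])

lemma t_less_t0:
  assumes "0 < \<gamma>" "0 < t0" "0 < k" shows "t k < t0"
proof -
  obtain j where "k = Suc j" using assms(3) by (metis gr0_implies_Suc)
  then show ?thesis using t_strict_decreasing[OF assms(1,2), of j] t_le[of j] by simp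
qed

end

section \<open>Local convergence of Newton's method\<close>

lemma newton_convergence:
  fixes a :: "'a::{real_inner, banach}" and r :: ereal
  assumes problem: "newton_problem \<Omega> F T a \<gamma>" and sub: "eball a r \<subseteq> \<Omega>"
    and r: "r \<le> ereal (5 - sqrt 17) / ereal (4 * \<gamma>)"
    and x0: "x0 \<in> eball a r" "x0 \<noteq> a"
  shows "newton_majorant \<gamma> (norm (x0 - a))"
    and "\<exists>x. newton_sequence \<Omega> F T x0 x \<and> (\<forall>k. \<exists>!y. newton_step F T (x k) y) \<and>
      (\<forall>k. x k \<in> eball a r) \<and> x \<longlonglongrightarrow> a \<and>
      (\<forall>k. norm (x k - a) \<le> scalar_sequence \<gamma> (norm (x0 - a)) k) \<and>
      (\<forall>k. norm (x (Suc k) - a) \<le>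
        \<gamma> / (2 * (1 - \<gamma> * scalar_sequence \<gamma> (norm (x0 - a)) k)\<^sup>2 - 1) * (norm (x k - a))\<^sup>2)"
proof -
  have nontrivial: "\<exists>v::'a. v \<noteq> 0" using x0(2) by (intro exI[of _ "x0 - a"]) simp
  have "newton_setting \<Omega> F T a \<gamma> 0" by unfold_locales (use problem nontrivial in auto)
  then have g0: "0 \<le> \<gamma>" by (rule newton_setting.gamma_nonneg)
  \<comment> \<open>For \<open>\<gamma> = 0\<close> the bound on \<open>r\<close> is infinite, and
    only the positivity of the constant is left to show.\<close>
  have small: "\<gamma> * s < (5 - sqrt 17) / 4" if "ereal s < r" for s
  proof (cases "\<gamma> = 0")
    case False
    then have "ereal s < ereal ((5 - sqrt 17) / (4 * \<gamma>))" using less_le_trans[OF that r] by simp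
    then show ?thesis using False g0 by (simp add: field_simps)
  qed (use radius_constant_bounds in simp)
  \<comment> \<open>The radius \<open>r\<close> may be infinite, so each point of the ball gets its
    own real radius \<open>R\<close> between its distance to \<open>a\<close> and
    \<open>r\<close>.\<close>
  have setting: "\<exists>R. norm (x - a) < R \<and> newton_setting \<Omega> F T a \<gamma> R" if "x \<in> eball a r" for x
  proof -
    have "ereal (norm (x - a)) < r" using that by (simp add: dist_norm norm_minus_commute)
    then obtain R where R: "ereal (norm (x - a)) < ereal R" "ereal R < r" using ereal_dense2 by blast
    have "ball a R \<subseteq> eball a r" using R(2) by (intro ball_eball_mono) simp
    moreover have "\<gamma> * R \<le> 1" using small[OF R(2)] radius_constant_bounds by linarith
    ultimately have "newton_setting \<Omega> F T a \<gamma> R"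
      by unfold_locales (use problem nontrivial sub in auto)
    then show ?thesis using R(1) by auto
  qed
  have n0: "ereal (norm (x0 - a)) < r" using x0(1) by (simp add: dist_norm norm_minus_commute)
  show maj: "newton_majorant \<gamma> (norm (x0 - a))"
    by unfold_locales (use g0 small[OF n0] in auto)
  interpret newton_majorant \<gamma> "norm (x0 - a)" by (rule maj)
  have in_ball: "x \<in> eball a r" if "norm (x - a) \<le> t k" for x k
  proof -
    have "ereal (norm (x - a)) \<le> ereal (norm (x0 - a))" using that t_le[of k] by simp
    then have "ereal (norm (x - a)) < r" using n0 by (rule le_less_trans)
    then show ?thesis by (simp add: dist_norm norm_minus_commute)
  qed
  have step: "\<exists>!y. newton_step F T x y"
    and bound: "newton_step F T x y \<Longrightarrow> norm (y - a) \<le> factor (norm (x - a)) * (norm (x - a))\<^sup>2"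
    if le: "norm (x - a) \<le> t k" for x y k
  proof -
    obtain R where R: "norm (x - a) < R" "newton_setting \<Omega> F T a \<gamma> R"
      using setting[OF in_ball[OF le]] by blast
    have "1 < 2 * (1 - \<gamma> * norm (x - a))\<^sup>2"
      using denominator_pos[of "norm (x - a)"] le t_le[of k] by simp
    then show "\<exists>!y. newton_step F T x y"
      and "newton_step F T x y \<Longrightarrow> norm (y - a) \<le> factor (norm (x - a)) * (norm (x - a))\<^sup>2"
      using newton_setting.newton_step_exists[OF R(2,1)] newton_setting.newton_step_bound[OF R(2,1)]
      by (simp_all add: factor_def)
  qed
  \<comment> \<open>That each description is proper is known only once \<open>inv\<close> places
    \<open>x k\<close> where steps exist uniquely.\<close>
  define x where "x = rec_nat x0 (\<lambda>_ x. THE y. newton_step F T x y)"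
  have x_0: "x 0 = x0" and x_Suc: "x (Suc k) = (THE y. newton_step F T (x k) y)" for k
    by (simp_all add: x_def)
  \<comment> \<open>The bound for one step involves the actual distance to \<open>a\<close>;
    monotonicity of \<open>factor\<close> transfers it to the majorant.\<close>
  have inv: "norm (x k - a) \<le> t k" for k
  proof (induction k)
    case (Suc k)
    have "newton_step F T (x k) (x (Suc k))" unfolding x_Suc by (rule theI'[OF step[OF Suc]])
    from bound[OF Suc this]
    have "norm (x (Suc k) - a) \<le> factor (norm (x k - a)) * (norm (x k - a))\<^sup>2" .
    also have "\<dots> \<le> factor (t k) * (t k)\<^sup>2"
      using Suc t_le[of k] by (intro mult_mono factor_mono power_mono factor_nonneg t_nonneg) auto
    finally show ?case by (simp only: t_Suc)
  qed (simp add: x_0)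
  have x_step: "newton_step F T (x k) (x (Suc k))" for k
    unfolding x_Suc by (rule theI'[OF step[OF inv]])
  have est: "norm (x (Suc k) - a) \<le> factor (t k) * (norm (x k - a))\<^sup>2" for k
  proof -
    have "norm (x (Suc k) - a) \<le> factor (norm (x k - a)) * (norm (x k - a))\<^sup>2"
      by (rule bound[OF inv x_step])
    also have "\<dots> \<le> factor (t k) * (norm (x k - a))\<^sup>2"
      by (intro mult_right_mono factor_mono inv t_le) auto
    finally show ?thesis .
  qed
  have "(\<lambda>k. norm (x k - a)) \<longlonglongrightarrow> 0"
    by (rule tendsto_sandwich[OF _ _ tendsto_const t_tendsto_0]) (use inv in auto)
  then have "x \<longlonglongrightarrow> a" by (simp add: tendsto_norm_zero_iff LIM_zero_iff)
  moreover have "newton_sequence \<Omega> F T x0 x"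
    unfolding newton_sequence_def using x_0 x_step in_ball[OF inv] sub by blast
  ultimately show "\<exists>x. newton_sequence \<Omega> F T x0 x \<and> (\<forall>k. \<exists>!y. newton_step F T (x k) y) \<and>
      (\<forall>k. x k \<in> eball a r) \<and> x \<longlonglongrightarrow> a \<and> (\<forall>k. norm (x k - a) \<le> t k) \<and>
      (\<forall>k. norm (x (Suc k) - a) \<le> \<gamma> / (2 * (1 - \<gamma> * t k)\<^sup>2 - 1) * (norm (x k - a))\<^sup>2)"
    using step[OF inv] in_ball[OF inv] inv est unfolding factor_def by blast
qed

lemma newton_solution_unique:
  fixes a :: "'a::{real_inner, banach}"
  assumes problem: "newton_problem \<Omega> F T a \<gamma>" and sub: "eball a r \<subseteq> \<Omega>"
    and x: "x \<in> eball a (min r (1 / ereal (2 * \<gamma>)))" and sol: "0 \<in> F x +o T x"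
  shows "x = a"
proof (rule ccontr)
  assume "x \<noteq> a"
  then have nontrivial: "\<exists>v::'a. v \<noteq> 0" by (intro exI[of _ "x - a"]) simp
  have "newton_setting \<Omega> F T a \<gamma> 0" by unfold_locales (use problem nontrivial in auto)
  then have g0: "0 \<le> \<gamma>" by (rule newton_setting.gamma_nonneg)
  have half: "\<gamma> * s < 1 / 2" if "ereal s < 1 / ereal (2 * \<gamma>)" for s
  proof (cases "\<gamma> = 0")
    case False
    then have "ereal s < ereal (1 / (2 * \<gamma>))" using that by (simp add: one_ereal_def)
    then show ?thesis using False g0 by (simp add: field_simps)
  qed simp
  have "ereal (norm (x - a)) < min r (1 / ereal (2 * \<gamma>))"
    using x by (simp add: dist_norm norm_minus_commute)
  then obtain R where R: "ereal (norm (x - a)) < ereal R" "ereal R < min r (1 / ereal (2 * \<gamma>))"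
    using ereal_dense2 by blast
  have "ball a R \<subseteq> eball a r" using R(2) by (intro ball_eball_mono) (simp add: less_imp_le)
  moreover have "\<gamma> * R \<le> 1" using half[of R] R(2) by simp
  ultimately have "newton_setting \<Omega> F T a \<gamma> R"
    by unfold_locales (use problem nontrivial sub in auto)
  moreover have "\<gamma> * norm (x - a) < 1 / 2"
    using \<open>ereal (norm (x - a)) < min r (1 / ereal (2 * \<gamma>))\<close> by (intro half) simp
  ultimately have "x - a = 0"
    using newton_setting.solution_unique[of \<Omega> F T a \<gamma> R "x - a"] R(1) sol by simp
  then show False using \<open>x \<noteq> a\<close> by simp
qed

section \<open>Optimality of the radius\<close>

lemma maximal_monotone_zero: "maximal_monotone_operator (\<lambda>_. {0::'a::real_inner})"
  unfolding maximal_monotone_operator_def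
proof (intro conjI allI impI)
  fix x u :: 'a
  assume "\<forall>y\<in>operator_domain (\<lambda>_. {0::'a}). \<forall>v\<in>{0}. 0 \<le> (u - v) \<bullet> (x - y)"
  \<comment> \<open>The test point \<open>x + u\<close> turns the hypothesis into
    \<open>0 \<le> - (u \<bullet> u)\<close>.\<close>
  then have "0 \<le> (u - 0) \<bullet> (x - (x + u))" unfolding operator_domain_def by blast
  then have "u \<bullet> u \<le> 0" by simp
  then show "u \<in> {0}" by (metis antisym inner_eq_zero_iff inner_ge_zero singletonI)
qed (auto simp: monotone_operator_def operator_domain_def)

section \<open>Ridge perturbations of the identity\<close>

lemma sym_part_ident: "sym_part (\<lambda>v::'a::real_inner. v) = (\<lambda>v. v)"
proof -
  have "adjoint (\<lambda>v::'a. v) = (\<lambda>v. v)" by (rule adjoint_unique) simp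
  then show ?thesis by (simp add: sym_part_def fun_eq_iff flip: scaleR_2)
qed

lemma onorm_identity:
  assumes "(e :: 'a::real_normed_vector) \<noteq> 0"
  shows "onorm (\<lambda>x::'a. x) = 1"
proof (rule antisym)
  show "onorm (\<lambda>x::'a. x) \<le> 1" unfolding onorm_def by (rule cSUP_least) auto
  show "1 \<le> onorm (\<lambda>x::'a. x)" using onorm[OF bounded_linear_ident, of e] assms by simp
qed

text \<open>Only the component along \<open>e\<close> is perturbed, so a scalar counterexample to
  Newton's method lives in every space that has a unit vector \<open>e\<close>.\<close>

definition ridge_map :: "(real \<Rightarrow> real) \<Rightarrow> 'a::real_inner \<Rightarrow> 'a \<Rightarrow> 'a" where
  "ridge_map f e x = x - f (x \<bullet> e) *\<^sub>R e"

text \<open>\<open>\<phi> n\<close> is the \<open>n\<close>-th derivative of the profile \<open>\<phi> 0\<close> on \<open>I\<close>.\<close>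

locale ridge =
  fixes \<phi> :: "nat \<Rightarrow> real \<Rightarrow> real" and I :: "real set" and e :: "'a::{real_inner, banach}" and \<Omega> :: "'a set"
  assumes deriv: "\<And>n s. s \<in> I \<Longrightarrow> (\<phi> n has_real_derivative \<phi> (Suc n) s) (at s)"
    and taylor: "\<And>s. s \<in> I \<Longrightarrow> \<exists>d>0. \<forall>s'. \<bar>s' - s\<bar> < d \<longrightarrow> (\<lambda>n. \<phi> n s * (s' - s) ^ n / fact n) sums \<phi> 0 s'"
    and e: "norm e = 1" and \<Omega>: "open \<Omega>" "0 \<in> \<Omega>" and I: "\<And>x. x \<in> \<Omega> \<Longrightarrow> x \<bullet> e \<in> I"
    and at_0: "\<phi> 0 0 = 0" "\<phi> (Suc 0) 0 = 0"
begin

abbreviation "F \<equiv> ridge_map (\<phi> 0) e"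

text \<open>Every derivative of \<open>\<lambda>x. \<phi> 0 (x \<bullet> e) *\<^sub>R e\<close> has
  this form, with \<open>c\<close> the scalar derivative of the same order.\<close>

definition rank_one :: "real \<Rightarrow> 'a list \<Rightarrow> 'a" where
  "rank_one c vs = (c * prod_list (map (\<lambda>v. v \<bullet> e) vs)) *\<^sub>R e"

definition ident_deriv :: "nat \<Rightarrow> 'a \<Rightarrow> 'a list \<Rightarrow> 'a" where
  "ident_deriv n x vs = (if n = 0 then x else if n = 1 then hd vs else 0)"

lemma abs_inner_le: "\<bar>v \<bullet> e\<bar> \<le> norm v"
  using Cauchy_Schwarz_ineq2[of v e] e by simp

lemma abs_prod_inner_le: "\<bar>prod_list (map (\<lambda>v. v \<bullet> e) vs)\<bar> \<le> prod_list (map norm vs)"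
  by (induction vs) (auto simp: abs_mult intro!: mult_mono abs_inner_le)

lemma inner_e_e: "e \<bullet> e = 1" using e by (simp add: norm_eq_1)

lemma linear_prod_inner:
  assumes "i < length vs"
  shows "linear (\<lambda>v. prod_list (map (\<lambda>v. v \<bullet> e) (vs[i := v])))"
  by (rule linearI) (simp_all add: upd_conv_take_nth_drop[OF assms] inner_add_left algebra_simps)

lemma multilinear_rank_one: "bounded_multilinear n (rank_one c)"
  unfolding bounded_multilinear_def
proof (intro conjI allI impI exI)
  fix vs :: "'a list" and i assume "length vs = n" "i < n"
  then have lin: "linear (\<lambda>v. prod_list (map (\<lambda>v. v \<bullet> e) (vs[i := v])))" by (intro linear_prod_inner) simp
  show "linear (\<lambda>v. rank_one c (vs[i := v]))"
    unfolding rank_one_def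
    by (rule linearI) (simp_all add: linear_add[OF lin] linear_scale[OF lin] algebra_simps)
next
  fix vs :: "'a list"
  show "norm (rank_one c vs) \<le> \<bar>c\<bar> * prod_list (map norm vs)"
    using mult_left_mono[OF abs_prod_inner_le, of "\<bar>c\<bar>" vs] by (simp add: rank_one_def e abs_mult)
qed

lemma multilinear_ident_deriv: "bounded_multilinear n (ident_deriv n x)"
  unfolding bounded_multilinear_def
proof (intro conjI allI impI exI)
  fix vs :: "'a list" and i assume *: "length vs = n" "i < n"
  show "linear (\<lambda>v. ident_deriv n x (vs[i := v]))"
  proof (cases "n = 1")
    case True
    then have "ident_deriv n x (vs[i := v]) = v" for v
      using * by (cases vs) (auto simp: ident_deriv_def)
    then show ?thesis by (simp add: linear_iff)
  next
    case False
    then show ?thesis using * by (simp add: ident_deriv_def linear_iff)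
  qed
next
  fix vs :: "'a list" assume "length vs = n"
  moreover have "0 \<le> prod_list (map norm vs)" by (rule prod_list_nonneg) auto
  ultimately show "norm (ident_deriv n x vs) \<le> (norm x + 1) * prod_list (map norm vs)"
    by (cases vs) (auto simp: ident_deriv_def mult_nonneg_nonneg distrib_right)
qed

text \<open>Cauchy-Schwarz in each argument gives the upper bound, which is attained when all
  arguments equal \<open>e\<close>.\<close>

lemma norm_rank_one: "multilinear_norm n (rank_one c) = \<bar>c\<bar>"
proof (rule antisym)
  show "multilinear_norm n (rank_one c) \<le> \<bar>c\<bar>"
  proof (rule multilinear_norm_leI)
    fix vs :: "'a list" assume "\<forall>v\<in>set vs. norm v \<le> 1"
    then have "prod_list (map norm vs) \<le> 1" using prod_list_le_one[of vs norm] by auto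
    then have "\<bar>prod_list (map (\<lambda>v. v \<bullet> e) vs)\<bar> \<le> 1" using abs_prod_inner_le[of vs] by linarith
    then show "norm (rank_one c vs) \<le> \<bar>c\<bar>"
      using mult_left_mono[of _ 1 "\<bar>c\<bar>"] by (simp add: rank_one_def e abs_mult)
  qed
  have "norm (rank_one c (replicate n e)) \<le> multilinear_norm n (rank_one c) * prod_list (map norm (replicate n e))"
    by (rule multilinear_norm_bound[OF multilinear_rank_one]) simp
  then show "\<bar>c\<bar> \<le> multilinear_norm n (rank_one c)"
    by (simp add: rank_one_def prod_list_replicate e inner_e_e)
qed

lemma profile_has_derivative:
  assumes "x \<in> \<Omega>"
  shows "((\<lambda>y. \<phi> n (y \<bullet> e)) has_derivative (\<lambda>v. \<phi> (Suc n) (x \<bullet> e) * (v \<bullet> e))) (at x)"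
proof -
  have "((\<lambda>y. y \<bullet> e) has_derivative (\<lambda>v. v \<bullet> e)) (at x)" by (auto intro!: derivative_eq_intros)
  moreover have "(\<phi> n has_derivative (*) (\<phi> (Suc n) (x \<bullet> e))) (at (x \<bullet> e))"
    using deriv[OF I[OF assms]] by (simp add: has_field_derivative_def)
  ultimately show ?thesis by (rule has_derivative_compose)
qed

lemma nth_frechet_ridge:
  "x \<in> \<Omega> \<Longrightarrow> length vs = n \<Longrightarrow>
    nth_frechet n F x vs = ident_deriv n x vs - rank_one (\<phi> n (x \<bullet> e)) vs"
proof (induction n arbitrary: x vs)
  case 0
  then show ?case by (simp add: ridge_map_def ident_deriv_def rank_one_def)
next
  case (Suc n)
  then obtain v ws where vs: "vs = v # ws" "length ws = n" by (metis length_Suc_conv)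
  have 1: "((\<lambda>y. ident_deriv n y ws) has_derivative (\<lambda>v. ident_deriv (Suc n) x (v # ws))) (at x)"
    by (cases n) (simp_all add: ident_deriv_def)
  have 2: "((\<lambda>y. rank_one (\<phi> n (y \<bullet> e)) ws) has_derivative (\<lambda>v. rank_one (\<phi> (Suc n) (x \<bullet> e)) (v # ws))) (at x)"
    using has_derivative_scaleR_left[OF has_derivative_mult_left[OF profile_has_derivative[OF Suc.prems(1), of n],
          of "prod_list (map (\<lambda>v. v \<bullet> e) ws)"], of e]
    by (simp add: rank_one_def mult.assoc)
  have "((\<lambda>y. nth_frechet n F y ws) has_derivative
      (\<lambda>v. ident_deriv (Suc n) x (v # ws) - rank_one (\<phi> (Suc n) (x \<bullet> e)) (v # ws))) (at x)"
    \<comment> \<open>The induction hypothesis holds only on \<open>\<Omega>\<close>; since this set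
      is open, it determines the derivative.\<close>
    by (rule has_derivative_transform_within_open[OF has_derivative_diff[OF 1 2] \<Omega>(1) Suc.prems(1)])
      (simp add: Suc.IH vs)
  from frechet_derivative_at[OF this] show ?case by (simp add: vs fun_eq_iff)
qed

text \<open>The identity part has no Taylor remainder, and that of the ridge part is rank one with
  the scalar remainder \<open>?r h\<close>, up to sign, as coefficient. By
  \<open>norm_rank_one\<close> the limit is differentiability of the profile.\<close>

lemma smooth: "smooth_map_on F \<Omega>"
  unfolding smooth_map_on_def
proof (intro allI ballI conjI)
  fix n x assume x: "x \<in> \<Omega>"
  have "bounded_multilinear n (\<lambda>vs. ident_deriv n x vs - rank_one (\<phi> n (x \<bullet> e)) vs)"
    by (rule bounded_multilinear_diff[OF multilinear_ident_deriv multilinear_rank_one])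
  then show "bounded_multilinear n (nth_frechet n F x)"
    unfolding bounded_multilinear_def by (simp add: nth_frechet_ridge[OF x])
  let ?r = "\<lambda>h. \<phi> n ((x + h) \<bullet> e) - \<phi> n (x \<bullet> e) - \<phi> (Suc n) (x \<bullet> e) * (h \<bullet> e)"
  have "((\<lambda>h. norm (?r h) / norm h) \<longlongrightarrow> 0) (at 0)"
    using profile_has_derivative[OF x, of n] by (simp only: has_derivative_at)
  moreover have "\<forall>\<^sub>F h in at 0. norm (?r h) / norm h =
      multilinear_norm n (\<lambda>vs. nth_frechet n F (x + h) vs - nth_frechet n F x vs
                                    - nth_frechet (Suc n) F x (h # vs)) / norm h"
  proof -
    have "((\<lambda>h. x + h) \<longlongrightarrow> x + 0) (at 0)" by (intro tendsto_intros)
    then have "\<forall>\<^sub>F h in at 0. x + h \<in> \<Omega>"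
      using \<Omega>(1) x by (simp add: topological_tendstoD)
    then show ?thesis
    proof eventually_elim
      case (elim h)
      have "multilinear_norm n (\<lambda>vs. nth_frechet n F (x + h) vs - nth_frechet n F x vs
          - nth_frechet (Suc n) F x (h # vs)) = multilinear_norm n (rank_one (- ?r h))"
      proof (rule multilinear_norm_cong)
        fix vs :: "'a list" assume vs: "length vs = n"
        have "ident_deriv n (x + h) vs - ident_deriv n x vs - ident_deriv (Suc n) x (h # vs) = 0"
          by (simp add: ident_deriv_def)
        then show "nth_frechet n F (x + h) vs - nth_frechet n F x vs - nth_frechet (Suc n) F x (h # vs)
            = rank_one (- ?r h) vs"
          unfolding nth_frechet_ridge[OF elim vs] nth_frechet_ridge[OF x vs]
            nth_frechet_ridge[OF x, of "h # vs" "Suc n", simplified length_Cons vs, OF refl]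
          by (simp add: rank_one_def algebra_simps)
      qed
      then show ?case by (simp only: norm_rank_one abs_minus_cancel real_norm_def)
    qed
  qed
  ultimately show "((\<lambda>h. multilinear_norm n (\<lambda>vs. nth_frechet n F (x + h) vs - nth_frechet n F x vs
                                    - nth_frechet (Suc n) F x (h # vs)) / norm h) \<longlongrightarrow> 0) (at 0)"
    by (rule Lim_transform_eventually)
qed

lemma analytic: "analytic_map_on F \<Omega>"
  unfolding analytic_map_on_def
proof (intro conjI ballI smooth)
  fix a assume a: "a \<in> \<Omega>"
  obtain d where d: "d > 0" "\<And>s'. \<bar>s' - a \<bullet> e\<bar> < d \<Longrightarrow>
      (\<lambda>n. \<phi> n (a \<bullet> e) * (s' - a \<bullet> e) ^ n / fact n) sums \<phi> 0 s'"
    using taylor[OF I[OF a]] by blast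
  have "(\<lambda>n. nth_frechet n F a (replicate n (x - a)) /\<^sub>R fact n) sums F x" if x: "x \<in> ball a d" for x
  proof -
    have "\<bar>x \<bullet> e - a \<bullet> e\<bar> < d"
      using abs_inner_le[of "x - a"] x by (simp add: inner_diff_left dist_norm norm_minus_commute)
    from bounded_linear.sums[OF bounded_linear_scaleR_left d(2)[OF this], of e]
    have 1: "(\<lambda>n. (\<phi> n (a \<bullet> e) * (x \<bullet> e - a \<bullet> e) ^ n / fact n) *\<^sub>R e) sums (\<phi> 0 (x \<bullet> e) *\<^sub>R e)" .
    have "(\<lambda>n. ident_deriv n a (replicate n (x - a)) /\<^sub>R fact n) sums
        (\<Sum>n\<in>{0, 1}. ident_deriv n a (replicate n (x - a)) /\<^sub>R fact n)"
      by (rule sums_finite) (auto simp: ident_deriv_def)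
    then have 2: "(\<lambda>n. ident_deriv n a (replicate n (x - a)) /\<^sub>R fact n) sums x"
      by (simp add: ident_deriv_def)
    have "nth_frechet n F a (replicate n (x - a)) /\<^sub>R fact n =
        ident_deriv n a (replicate n (x - a)) /\<^sub>R fact n
        - (\<phi> n (a \<bullet> e) * (x \<bullet> e - a \<bullet> e) ^ n / fact n) *\<^sub>R e" for n
      by (simp add: nth_frechet_ridge[OF a] rank_one_def prod_list_replicate inner_diff_left
          scaleR_diff_right divide_inverse mult_ac)
    then show ?thesis using sums_diff[OF 2 1] by (simp add: ridge_map_def)
  qed
  then show "\<exists>e>0. \<forall>x\<in>ball a e. (\<lambda>n. nth_frechet n F a (replicate n (x - a)) /\<^sub>R fact n) sums F x"
    using d(1) by blast
qed

lemma derivative_ridge: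
  assumes "x \<in> \<Omega>"
  shows "frechet_derivative F (at x) v = v - (\<phi> (Suc 0) (x \<bullet> e) * (v \<bullet> e)) *\<^sub>R e"
  using nth_frechet_ridge[OF assms, of "[v]" "Suc 0"] by (simp add: ident_deriv_def rank_one_def)

lemma derivative_at_0: "frechet_derivative F (at 0) = (\<lambda>v. v)"
  using derivative_ridge[OF \<Omega>(2)] at_0 by (simp add: fun_eq_iff)

text \<open>The derivative at 0 is the identity, so \<open>\<beta> = 1\<close> and the first branch
  of \<open>newton_gamma\<close> is the supremum over the scalar Taylor coefficients.\<close>

lemma newton_problem_ridge:
  assumes "(SUP n\<in>{2..}. ereal (root (n - 1) (\<bar>\<phi> n 0\<bar> / fact n))) = ereal \<gamma>"
  shows "newton_problem \<Omega> F (\<lambda>_. {0}) 0 \<gamma>"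
proof -
  have inv: "inv (\<lambda>v::'a. v) = (\<lambda>v. v)" using inv_id unfolding id_def .
  have e0: "e \<noteq> 0" using e by auto
  have "multilinear_norm n (\<lambda>vs. nth_frechet n F 0 vs /\<^sub>R fact n) = \<bar>\<phi> n 0\<bar> / fact n" if "2 \<le> n" for n
  proof -
    have "multilinear_norm n (\<lambda>vs. nth_frechet n F 0 vs /\<^sub>R fact n) = multilinear_norm n (rank_one (- \<phi> n 0 / fact n))"
      by (rule multilinear_norm_cong)
        (use that in \<open>simp add: nth_frechet_ridge[OF \<Omega>(2)] ident_deriv_def rank_one_def divide_inverse mult_ac\<close>)
    then show ?thesis by (simp add: norm_rank_one)
  qed
  then have "(SUP n\<in>{2..}. ereal (root (n - 1) (multilinear_norm n (\<lambda>vs. nth_frechet n F 0 vs /\<^sub>R fact n))))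
      = ereal \<gamma>"
    unfolding assms[symmetric] by (intro SUP_cong) auto
  then have "newton_gamma F 0 = ereal \<gamma>"
    by (simp add: newton_gamma_def derivative_at_0 sym_part_ident inv onorm_identity[OF e0] flip: one_ereal_def)
  moreover have "invertible_operator (\<lambda>v::'a. v)"
    unfolding invertible_operator_def inv by (simp add: bounded_linear_ident bij_def)
  moreover have "positive_operator (\<lambda>v::'a. v)"
    unfolding positive_operator_def by (simp add: bounded_linear_ident)
  moreover have "F 0 = 0" by (simp add: ridge_map_def at_0)
  ultimately show ?thesis
    unfolding newton_problem_def derivative_at_0 sym_part_ident
    using \<Omega> analytic maximal_monotone_zero by (simp add: zero_in_elt_set_plus)
qed

text \<open>The component along \<open>e\<close> of the first Newton equation is the scalar Newton
  equation, and by \<open>no\<close> its solutions lie outside \<open>\<Omega>\<close>.\<close>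

lemma no_newton_sequence:
  assumes s: "s *\<^sub>R e \<in> \<Omega>"
    and no: "\<And>z. z \<in> \<Omega> \<Longrightarrow> (1 - \<phi> (Suc 0) s) * (z \<bullet> e) \<noteq> \<phi> 0 s - s * \<phi> (Suc 0) s"
  shows "\<not> newton_sequence \<Omega> F (\<lambda>_. {0}) (s *\<^sub>R e) x"
proof
  assume "newton_sequence \<Omega> F (\<lambda>_. {0}) (s *\<^sub>R e) x"
  then have "x 0 = s *\<^sub>R e" and x1: "x (Suc 0) \<in> \<Omega>"
    and "newton_step F (\<lambda>_. {0}) (x 0) (x (Suc 0))"
    unfolding newton_sequence_def by blast+
  then have "F (s *\<^sub>R e) + frechet_derivative F (at (s *\<^sub>R e)) (x (Suc 0) - s *\<^sub>R e) = 0"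
    unfolding newton_step_def zero_in_elt_set_plus by (simp add: neg_eq_iff_add_eq_0 add_eq_0_iff)
  then have "(F (s *\<^sub>R e) + frechet_derivative F (at (s *\<^sub>R e)) (x (Suc 0) - s *\<^sub>R e)) \<bullet> e = 0" by simp
  then have "(1 - \<phi> (Suc 0) s) * (x (Suc 0) \<bullet> e) = \<phi> 0 s - s * \<phi> (Suc 0) s"
    by (simp add: derivative_ridge[OF s] ridge_map_def inner_e_e inner_add_left inner_diff_left algebra_simps)
  then show False using no[OF x1] by blast
qed

lemma not_convergence_radius:
  assumes "(SUP n\<in>{2..}. ereal (root (n - 1) (\<bar>\<phi> n 0\<bar> / fact n))) = ereal \<gamma>"
    and R: "eball 0 R \<subseteq> \<Omega>" and s: "s \<noteq> 0" "ereal \<bar>s\<bar> < R"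
    and no: "\<And>z. z \<in> \<Omega> \<Longrightarrow> (1 - \<phi> (Suc 0) s) * (z \<bullet> e) \<noteq> \<phi> 0 s - s * \<phi> (Suc 0) s"
  shows "\<not> convergence_radius TYPE('a) \<gamma> R"
proof
  assume c: "convergence_radius TYPE('a) \<gamma> R"
  have e0: "e \<noteq> 0" using e by auto
  have mem: "s *\<^sub>R e \<in> eball 0 R - {0}" using s e e0 by simp
  from c newton_problem_ridge[OF assms(1)] R mem
  obtain x where "newton_sequence \<Omega> F (\<lambda>_. {0}) (s *\<^sub>R e) x"
    unfolding convergence_radius_def by blast
  moreover have "s *\<^sub>R e \<in> \<Omega>" using mem R by blast
  ultimately show False using no_newton_sequence[OF _ no] by blast
qed

end

section \<open>The quadratic and the geometric test profile\<close>

definition quadratic_profile :: "real \<Rightarrow> nat \<Rightarrow> real \<Rightarrow> real" where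
  "quadratic_profile \<gamma> n s = (if n = 0 then \<gamma> * s\<^sup>2 else if n = 1 then 2 * \<gamma> * s else if n = 2 then 2 * \<gamma> else 0)"

lemma quadratic_ridge:
  assumes "norm (e :: 'a::{real_inner, banach}) = 1"
  shows "ridge (quadratic_profile \<gamma>) UNIV e UNIV"
proof
  fix n :: nat and s :: real
  consider "n = 0" | "n = 1" | "n = 2" | "2 < n" by linarith
  then show "(quadratic_profile \<gamma> n has_real_derivative quadratic_profile \<gamma> (Suc n) s) (at s)"
    unfolding quadratic_profile_def by cases (auto intro!: derivative_eq_intros)
next
  fix s :: real
  have "(\<lambda>n. quadratic_profile \<gamma> n s * (s' - s) ^ n / fact n) sums quadratic_profile \<gamma> 0 s'" for s'
  proof -
    have "(\<lambda>n. quadratic_profile \<gamma> n s * (s' - s) ^ n / fact n) sums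
        (\<Sum>n\<in>{0, 1, 2}. quadratic_profile \<gamma> n s * (s' - s) ^ n / fact n)"
      by (rule sums_finite) (auto simp: quadratic_profile_def)
    moreover have "(\<Sum>n\<in>{0, 1, 2}. quadratic_profile \<gamma> n s * (s' - s) ^ n / fact n) = quadratic_profile \<gamma> 0 s'"
      by (simp add: quadratic_profile_def power2_eq_square field_simps)
    ultimately show ?thesis by simp
  qed
  then show "\<exists>d>0. \<forall>s'. \<bar>s' - s\<bar> < d \<longrightarrow> (\<lambda>n. quadratic_profile \<gamma> n s * (s' - s) ^ n / fact n) sums quadratic_profile \<gamma> 0 s'"
    using zero_less_one by blast
qed (use assms in \<open>auto simp: quadratic_profile_def\<close>)

lemma quadratic_sup:
  assumes "0 < \<gamma>"
  shows "(SUP n\<in>{2..}. ereal (root (n - 1) (\<bar>quadratic_profile \<gamma> n 0\<bar> / fact n))) = ereal \<gamma>"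
proof (rule antisym)
  show "(SUP n\<in>{2..}. ereal (root (n - 1) (\<bar>quadratic_profile \<gamma> n 0\<bar> / fact n))) \<le> ereal \<gamma>"
    by (rule SUP_least) (use assms in \<open>auto simp: quadratic_profile_def\<close>)
  have "ereal (root (2 - 1) (\<bar>quadratic_profile \<gamma> 2 0\<bar> / fact 2)) \<le>
      (SUP n\<in>{2..}. ereal (root (n - 1) (\<bar>quadratic_profile \<gamma> n 0\<bar> / fact n)))"
    by (rule SUP_upper) simp
  then show "ereal \<gamma> \<le> (SUP n\<in>{2..}. ereal (root (n - 1) (\<bar>quadratic_profile \<gamma> n 0\<bar> / fact n)))"
    using assms by (simp add: quadratic_profile_def)
qed

text \<open>The derivatives of \<open>\<gamma> * s\<^sup>2 / (1 - \<gamma> * s) = 1 / (\<gamma> * (1 - \<gamma> * s)) - 1 / \<gamma> - s\<close>.\<close>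

definition geometric_profile :: "real \<Rightarrow> nat \<Rightarrow> real \<Rightarrow> real" where
  "geometric_profile \<gamma> n s = fact n * \<gamma> ^ n / (\<gamma> * (1 - \<gamma> * s) ^ Suc n)
     - (if n = 0 then 1 / \<gamma> + s else if n = 1 then 1 else 0)"

text \<open>The condition \<open>\<gamma> * R \<le> 1\<close> keeps \<open>x \<bullet> e\<close>
  below the pole \<open>1 / \<gamma>\<close> of the profile.\<close>

lemma geometric_ridge:
  assumes e: "norm (e :: 'a::{real_inner, banach}) = 1" and g: "0 < \<gamma>" and R: "0 < R" "\<gamma> * R \<le> 1"
  shows "ridge (geometric_profile \<gamma>) {s. \<gamma> * s < 1} e (ball 0 R)"
proof
  fix n s assume "s \<in> {s. \<gamma> * s < 1}"
  then have w: "1 - \<gamma> * s \<noteq> 0" by simp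
  have "((\<lambda>s. fact n * \<gamma> ^ n / (\<gamma> * (1 - \<gamma> * s) ^ Suc n)) has_real_derivative
      fact (Suc n) * \<gamma> ^ Suc n / (\<gamma> * (1 - \<gamma> * s) ^ Suc (Suc n))) (at s)"
  proof -
    have "((\<lambda>s. fact n * \<gamma> ^ n / \<gamma> * inverse ((1 - \<gamma> * s) ^ Suc n)) has_real_derivative
      fact n * \<gamma> ^ n / \<gamma> * (- (inverse ((1 - \<gamma> * s) ^ Suc n) * (real (Suc n) * (1 - \<gamma> * s) ^ n * (- \<gamma>)) * inverse ((1 - \<gamma> * s) ^ Suc n)))) (at s)"
    proof (intro DERIV_cmult DERIV_inverse')
      have "((\<lambda>s. 1 - \<gamma> * s) has_real_derivative - \<gamma>) (at s)" by (auto intro!: derivative_eq_intros)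
      from DERIV_power_Suc[OF this, of n]
      show "((\<lambda>s. (1 - \<gamma> * s) ^ Suc n) has_real_derivative real (Suc n) * (1 - \<gamma> * s) ^ n * (- \<gamma>)) (at s)"
        by (simp add: mult_ac)
    qed (use w in simp)
    moreover have "fact n * \<gamma> ^ n / \<gamma> * (- (inverse ((1 - \<gamma> * s) ^ Suc n) * (real (Suc n) * (1 - \<gamma> * s) ^ n * (- \<gamma>)) * inverse ((1 - \<gamma> * s) ^ Suc n)))
      = fact (Suc n) * \<gamma> ^ Suc n / (\<gamma> * (1 - \<gamma> * s) ^ Suc (Suc n))"
    proof -
      define q where "q = 1 - \<gamma> * s"
      have "q \<noteq> 0" using w by (simp add: q_def)
      then show ?thesis using g unfolding q_def[symmetric] by (simp add: divide_inverse mult_ac)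
    qed
    moreover have "(\<lambda>s. fact n * \<gamma> ^ n / (\<gamma> * (1 - \<gamma> * s) ^ Suc n))
        = (\<lambda>s. fact n * \<gamma> ^ n / \<gamma> * inverse ((1 - \<gamma> * s) ^ Suc n))"
      by (simp add: fun_eq_iff divide_inverse mult.assoc del: power_Suc)
    ultimately show ?thesis by (simp only:)
  qed
  moreover have "((\<lambda>s. if n = 0 then 1 / \<gamma> + s else if n = 1 then 1 else 0) has_real_derivative
      (if Suc n = 0 then 1 / \<gamma> + s else if Suc n = 1 then 1 else 0)) (at s)"
    by (cases "n = 0") (auto intro!: derivative_eq_intros)
  ultimately show "(geometric_profile \<gamma> n has_real_derivative geometric_profile \<gamma> (Suc n) s) (at s)"
    unfolding geometric_profile_def by (rule DERIV_diff)
next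
  fix s assume "s \<in> {s. \<gamma> * s < 1}"
  then have w: "0 < 1 - \<gamma> * s" by simp
  have "(\<lambda>n. geometric_profile \<gamma> n s * (s' - s) ^ n / fact n) sums geometric_profile \<gamma> 0 s'"
    if s': "\<bar>s' - s\<bar> < (1 - \<gamma> * s) / \<gamma>" for s'
  proof -
    \<comment> \<open>The bound on \<open>s' - s\<close> is the distance from \<open>s\<close> to
      the pole; within it the expansion about \<open>s\<close> is a geometric series in
      \<open>q\<close>.\<close>
    define q where "q = \<gamma> * (s' - s) / (1 - \<gamma> * s)"
    have "\<gamma> * \<bar>s' - s\<bar> < 1 - \<gamma> * s" using s' g by (simp add: field_simps)
    then have q: "norm q < 1" using g w by (simp add: q_def abs_mult)
    have "1 - q = (1 - \<gamma> * s') / (1 - \<gamma> * s)" using w by (simp add: q_def field_simps)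
    then have "1 / (\<gamma> * (1 - \<gamma> * s)) * (1 / (1 - q)) = 1 / (\<gamma> * (1 - \<gamma> * s'))"
      using w by simp
    with sums_mult[OF geometric_sums[OF q], of "1 / (\<gamma> * (1 - \<gamma> * s))"]
    have 1: "(\<lambda>n. 1 / (\<gamma> * (1 - \<gamma> * s)) * q ^ n) sums (1 / (\<gamma> * (1 - \<gamma> * s')))" by (simp only:)
    let ?c = "\<lambda>n::nat. (if n = 0 then 1 / \<gamma> + s else if n = 1 then 1 else 0)"
    have "(\<lambda>n. ?c n * (s' - s) ^ n / fact n) sums (\<Sum>n\<in>{0, 1}. ?c n * (s' - s) ^ n / fact n)"
      by (rule sums_finite) auto
    then have 2: "(\<lambda>n. ?c n * (s' - s) ^ n / fact n) sums (1 / \<gamma> + s')" by simp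
    have "geometric_profile \<gamma> n s * (s' - s) ^ n / fact n
        = 1 / (\<gamma> * (1 - \<gamma> * s)) * q ^ n - ?c n * (s' - s) ^ n / fact n" for n
    proof -
      have "fact n * \<gamma> ^ n / (\<gamma> * (1 - \<gamma> * s) ^ Suc n) * (s' - s) ^ n / fact n = 1 / (\<gamma> * (1 - \<gamma> * s)) * q ^ n"
        by (simp add: q_def power_divide power_mult_distrib)
      then show ?thesis unfolding geometric_profile_def by (simp only: left_diff_distrib diff_divide_distrib)
    qed
    moreover have "1 / (\<gamma> * (1 - \<gamma> * s')) - (1 / \<gamma> + s') = geometric_profile \<gamma> 0 s'"
      by (simp add: geometric_profile_def)
    ultimately show ?thesis using sums_diff[OF 1 2] by simp
  qed
  moreover have "0 < (1 - \<gamma> * s) / \<gamma>" using w g by simp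
  ultimately show "\<exists>d>0. \<forall>s'. \<bar>s' - s\<bar> < d \<longrightarrow> (\<lambda>n. geometric_profile \<gamma> n s * (s' - s) ^ n / fact n) sums geometric_profile \<gamma> 0 s'"
    by blast
next
  fix x :: 'a assume "x \<in> ball 0 R"
  then have "x \<bullet> e < R" using norm_cauchy_schwarz[of x e] e by simp
  then have "\<gamma> * (x \<bullet> e) < \<gamma> * R" using g by simp
  then show "x \<bullet> e \<in> {s. \<gamma> * s < 1}" using R by simp
qed (use e g R in \<open>auto simp: geometric_profile_def\<close>)

text \<open>The Taylor coefficient of order \<open>n \<ge> 2\<close> at 0 is exactly
  \<open>\<gamma> ^ (n - 1)\<close>, so all the roots coincide.\<close>

lemma geometric_sup:
  assumes "0 < \<gamma>"
  shows "(SUP n\<in>{2..}. ereal (root (n - 1) (\<bar>geometric_profile \<gamma> n 0\<bar> / fact n))) = ereal \<gamma>"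
proof -
  have "root (n - 1) (\<bar>geometric_profile \<gamma> n 0\<bar> / fact n) = \<gamma>" if n: "2 \<le> n" for n
  proof -
    obtain m where m: "n = Suc (Suc m)" using n by (metis Suc_le_D numeral_2_eq_2 Suc_le_mono)
    have "\<bar>geometric_profile \<gamma> n 0\<bar> / fact n = \<gamma> ^ Suc m"
      using assms by (simp add: geometric_profile_def m abs_mult del: fact_Suc)
    then show ?thesis using assms real_root_power_cancel[of "Suc m" \<gamma>] by (simp add: m)
  qed
  then have "(SUP n\<in>{2..}. ereal (root (n - 1) (\<bar>geometric_profile \<gamma> n 0\<bar> / fact n))) = (SUP n\<in>{2::nat..}. ereal \<gamma>)"
    by (intro SUP_cong) auto
  then show ?thesis by simp
qed

text \<open>The Newton iterate of \<open>x - \<gamma> * x\<^sup>2 / (1 - \<gamma> * x)\<close> at \<open>s > 0\<close> is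
  \<open>- \<gamma> * s\<^sup>2 / (2 * (1 - \<gamma> * s)\<^sup>2 - 1)\<close>, and it lies outside the domain \<open>{-R<..<R}\<close> for a suitable \<open>s\<close>.\<close>

lemma escaping_point:
  fixes \<gamma> R :: real
  assumes g: "0 < \<gamma>" and R: "(5 - sqrt 17) / 4 < \<gamma> * R" "\<gamma> * R \<le> 1 / 2"
  obtains s where "0 < s" "s < R" "0 \<le> 2 * (1 - \<gamma> * s)\<^sup>2 - 1" "R * (2 * (1 - \<gamma> * s)\<^sup>2 - 1) < \<gamma> * s\<^sup>2"
proof -
  have "0 < (5 - sqrt 17) / 4" using radius_constant_bounds(1) by simp
  also note R(1)
  finally have "0 < \<gamma> * R" .
  then have R0: "0 < R" using g by (rule zero_less_mult_pos)
  \<comment> \<open>At \<open>s1\<close> the denominator of the iterate vanishes. If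
    \<open>s1 < R\<close>, this point itself serves as a start.\<close>
  define s1 where "s1 = (1 - 1 / sqrt 2) / \<gamma>"
  have s1: "1 - \<gamma> * s1 = 1 / sqrt 2" using g by (simp add: s1_def)
  have s1_pos: "0 < s1" using g by (simp add: s1_def)
  show thesis
  proof (cases "s1 < R")
    case True
    have "2 * (1 - \<gamma> * s1)\<^sup>2 - 1 = 0" unfolding s1 by (simp add: power_divide)
    then show thesis using that[of s1] True s1_pos g by simp
  next
    case False
    \<comment> \<open>A positive value means that the iterate overshoots \<open>R\<close>. This
      holds at \<open>R\<close>, since \<open>\<gamma> * R\<close> lies between the roots of
      \<open>2 * u\<^sup>2 - 5 * u + 1\<close>, and by continuity slightly to the left. There
      \<open>s < s1\<close>, so the denominator is nonnegative.\<close>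
    let ?f = "\<lambda>s. \<gamma> * s\<^sup>2 - R * (2 * (1 - \<gamma> * s)\<^sup>2 - 1)"
    have q: "sqrt 17 * sqrt 17 = 17" "0 \<le> sqrt 17" by simp_all
    have "0 < (\<gamma> * R - (5 - sqrt 17) / 4) * ((5 + sqrt 17) / 4 - \<gamma> * R)"
    proof (intro mult_pos_pos)
      have "1 / 2 < (5 + sqrt 17) / 4" using q(2) by argo
      then show "0 < (5 + sqrt 17) / 4 - \<gamma> * R" using R(2) by linarith
    qed (use R(1) in simp)
    also have "\<dots> = (\<gamma> * R - (2 * (1 - \<gamma> * R)\<^sup>2 - 1)) / 2"
      using q(1) by (simp add: power2_eq_square field_simps)
    finally have "0 < R * (\<gamma> * R - (2 * (1 - \<gamma> * R)\<^sup>2 - 1))" using R0 by simp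
    then have pos: "0 < ?f R" by (simp add: power2_eq_square algebra_simps)
    have "(?f \<longlongrightarrow> ?f R) (at_left R)" by (intro tendsto_intros)
    then have "\<forall>\<^sub>F s in at_left R. 0 < ?f s" using pos by (rule order_tendstoD)
    then have "\<forall>\<^sub>F s in at_left R. 0 < ?f s \<and> s \<in> {0<..<R}"
      using eventually_at_left_real[OF R0] by (rule eventually_conj)
    then obtain s where s: "0 < ?f s" "0 < s" "s < R"
      using eventually_happens[of _ "at_left R"] by (auto simp: trivial_limit_at_left_real)
    have "\<gamma> * s \<le> \<gamma> * s1" using g s(3) False by simp
    then have "1 / sqrt 2 \<le> 1 - \<gamma> * s" using s1 by linarith
    then have "(1 / sqrt 2)\<^sup>2 \<le> (1 - \<gamma> * s)\<^sup>2" by (rule power_mono) simp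
    then have "0 \<le> 2 * (1 - \<gamma> * s)\<^sup>2 - 1" by (simp add: power_divide)
    then show thesis using that s by simp
  qed
qed

text \<open>The geometric profile has a pole and handles radii up to
  \<open>1 / (2 * \<gamma>)\<close>. For larger, possibly infinite radii the quadratic profile is
  used, which is defined everywhere.\<close>

lemma not_convergence_radius_above:
  assumes e: "norm (e :: 'a::{real_inner, banach}) = 1" and g: "0 < \<gamma>"
    and R: "ereal ((5 - sqrt 17) / (4 * \<gamma>)) < R"
  shows "\<not> convergence_radius TYPE('a) \<gamma> R"
proof (cases "ereal (1 / (2 * \<gamma>)) < R")
  case True
  show ?thesis
  \<comment> \<open>The start \<open>1 / (2 * \<gamma>)\<close> is the critical point of
    \<open>s - \<gamma> * s\<^sup>2\<close>: the left side of the Newton equation is 0, the right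
    side \<open>- 1 / (4 * \<gamma>)\<close>.\<close>
  proof (rule ridge.not_convergence_radius[OF quadratic_ridge[OF e] quadratic_sup[OF g]])
    show "1 / (2 * \<gamma>) \<noteq> 0" "ereal \<bar>1 / (2 * \<gamma>)\<bar> < R" using g True by auto
    show "(1 - quadratic_profile \<gamma> (Suc 0) (1 / (2 * \<gamma>))) * (z \<bullet> e)
        \<noteq> quadratic_profile \<gamma> 0 (1 / (2 * \<gamma>)) - 1 / (2 * \<gamma>) * quadratic_profile \<gamma> (Suc 0) (1 / (2 * \<gamma>))" for z
      using g by (simp add: quadratic_profile_def power2_eq_square field_simps)
  qed simp
next
  case False
  then obtain R' where R': "R = ereal R'" using R by (cases R) auto
  have gR: "(5 - sqrt 17) / 4 < \<gamma> * R'" "\<gamma> * R' \<le> 1 / 2"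
    using R False g by (simp_all add: R' field_simps)
  have "0 < (5 - sqrt 17) / 4" using radius_constant_bounds(1) by simp
  also note gR(1)
  finally have "0 < \<gamma> * R'" .
  then have R0: "0 < R'" using g by (rule zero_less_mult_pos)
  obtain s where s: "0 < s" "s < R'" "0 \<le> 2 * (1 - \<gamma> * s)\<^sup>2 - 1" "R' * (2 * (1 - \<gamma> * s)\<^sup>2 - 1) < \<gamma> * s\<^sup>2"
    by (rule escaping_point[OF g gR])
  show ?thesis
  proof (rule ridge.not_convergence_radius[OF geometric_ridge[OF e g R0] geometric_sup[OF g]])
    show "\<gamma> * R' \<le> 1" "eball 0 R \<subseteq> ball 0 R'" "s \<noteq> 0" "ereal \<bar>s\<bar> < R"
      using gR s by (auto simp: R')
    fix z :: 'a assume z: "z \<in> ball 0 R'"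
    define w where "w = 1 - \<gamma> * s"
    have "\<gamma> * s < \<gamma> * R'" using g s by simp
    then have w: "0 < w" using gR by (simp add: w_def)
    \<comment> \<open>Multiplying the Newton equation by \<open>w\<^sup>2\<close> clears its
      denominators and produces the expressions of \<open>escaping_point\<close>.\<close>
    have 1: "w\<^sup>2 * (1 - geometric_profile \<gamma> (Suc 0) s) = 2 * w\<^sup>2 - 1"
      using w g by (simp add: geometric_profile_def power2_eq_square field_simps flip: w_def)
    have 2: "w\<^sup>2 * (geometric_profile \<gamma> 0 s - s * geometric_profile \<gamma> (Suc 0) s) = - \<gamma> * s\<^sup>2"
    proof -
      have "\<gamma> * (w\<^sup>2 * (geometric_profile \<gamma> 0 s - s * geometric_profile \<gamma> (Suc 0) s)) = w - w\<^sup>2 - \<gamma> * s"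
        using w g by (simp add: geometric_profile_def power2_eq_square field_simps flip: w_def)
      also have "\<dots> = \<gamma> * (- \<gamma> * s\<^sup>2)"
        by (simp add: w_def power2_eq_square algebra_simps)
      finally show ?thesis by (rule mult_left_cancel[THEN iffD1, rotated]) (use g in simp)
    qed
    have "\<bar>z \<bullet> e\<bar> \<le> R'" using z Cauchy_Schwarz_ineq2[of z e] e by simp
    \<comment> \<open>The right side \<open>- \<gamma> * s\<^sup>2\<close> is negative, so the lower
      end of the domain is the one to exclude.\<close>
    then have "- R' \<le> z \<bullet> e" by simp
    then have "(2 * w\<^sup>2 - 1) * (- R') \<le> (2 * w\<^sup>2 - 1) * (z \<bullet> e)"
      using s(3) by (intro mult_left_mono) (simp_all add: w_def)
    then have ne: "(2 * w\<^sup>2 - 1) * (z \<bullet> e) \<noteq> - \<gamma> * s\<^sup>2"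
      using s(4) by (simp add: w_def[symmetric] mult.commute)
    show "(1 - geometric_profile \<gamma> (Suc 0) s) * (z \<bullet> e) \<noteq>
        geometric_profile \<gamma> 0 s - s * geometric_profile \<gamma> (Suc 0) s"
      using ne unfolding 1[symmetric] 2[symmetric] by (auto simp: mult.assoc)
  qed
qed

text \<open>Shows that \<open>\<gamma> \<noteq> 0\<close> forces a nonzero vector: in the zero space
  the inverse has norm 0, and the second branch takes roots of 0.\<close>

lemma newton_gamma_trivial:
  assumes "\<And>v::'a::real_inner. v = 0"
  shows "newton_gamma F (x::'a) = 0"
proof -
  have "inv (sym_part (frechet_derivative F (at x))) = (\<lambda>_. 0)" by (intro ext assms)
  then have "onorm (inv (sym_part (frechet_derivative F (at x)))) = 0" by (simp add: onorm_zero)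
  then show ?thesis by (simp add: newton_gamma_def Let_def zero_ereal_def)
qed

section \<open>Convergence radius and the full statement\<close>

lemma convergence_radius_constant:
  "convergence_radius TYPE('a::{real_inner, banach}) \<gamma> (ereal (5 - sqrt 17) / ereal (4 * \<gamma>))"
  unfolding convergence_radius_def
proof (intro allI impI ballI)
  fix \<Omega> :: "'a set" and F T xstar x0
  assume "newton_problem \<Omega> F T xstar \<gamma> \<and> eball xstar (ereal (5 - sqrt 17) / ereal (4 * \<gamma>)) \<subseteq> \<Omega>"
    and "x0 \<in> eball xstar (ereal (5 - sqrt 17) / ereal (4 * \<gamma>)) - {xstar}"
  then show "\<exists>x. newton_sequence \<Omega> F T x0 x \<and> x \<longlonglongrightarrow> xstar"
    using newton_convergence(2)[of \<Omega> F T xstar \<gamma> _ x0, OF _ _ order_refl] by blast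
qed

text \<open>For \<open>\<gamma> = 0\<close> every \<open>t k\<close> with \<open>k > 0\<close>
  vanishes, so the strict claims about \<open>t\<close> assume \<open>\<gamma> \<noteq> 0\<close>;
  \<open>\<rho>\<close> and \<open>1 / ereal (2 * \<gamma>)\<close> are then infinite. At
  \<open>k = 0\<close> the quotient equals its bound, so strictness starts at
  \<open>k > 0\<close>.\<close>

theorem theorem13:
  fixes \<Omega> :: "'a::{real_inner, banach} set"
    and F :: "'a \<Rightarrow> 'a" and T :: "'a \<Rightarrow> 'a set" and xstar :: 'a
    and \<gamma> :: real and \<kappa> \<rho> r \<sigma> :: ereal
  assumes "open \<Omega>" and "\<Omega> \<noteq> {}"
    and "analytic_map_on F \<Omega>"
    and "maximal_monotone_operator T"
    and "xstar \<in> \<Omega>"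
    and "0 \<in> F xstar +o T xstar"
    and "positive_operator (frechet_derivative F (at xstar))"
    and "invertible_operator (sym_part (frechet_derivative F (at xstar)))"
    and "newton_gamma F xstar = ereal \<gamma>"
    and "\<kappa> = (SUP t \<in> {t. 0 < t \<and> ball xstar t \<subseteq> \<Omega>}. ereal t)"
    and "\<rho> = ereal (5 - sqrt 17) / ereal (4 * \<gamma>)"
    and "r = min \<kappa> \<rho>"
    and "\<sigma> = min r (1 / ereal (2 * \<gamma>))"
  shows "(\<forall>x0 \<in> eball xstar r - {xstar}. \<forall>t. t = scalar_sequence \<gamma> (norm (xstar - x0)) \<longrightarrow>
            (\<forall>k. 2 * (1 - \<gamma> * t k)\<^sup>2 - 1 \<noteq> 0) \<and>
            (\<forall>k. 0 \<le> t k \<and> ereal (t k) < r) \<and> t \<longlonglongrightarrow> 0 \<and>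
            (\<gamma> \<noteq> 0 \<longrightarrow>
               (\<forall>k. t (Suc k) < t k) \<and> (\<forall>k. 0 < t k) \<and>
               (\<forall>k. t (Suc (Suc k)) / (t (Suc k))\<^sup>2 < t (Suc k) / (t k)\<^sup>2) \<and>
               (\<forall>k. t (Suc k) / (t k)\<^sup>2 \<le> \<gamma> / (2 * (1 - \<gamma> * norm (x0 - xstar))\<^sup>2 - 1)) \<and>
               (\<forall>k>0. t (Suc k) / (t k)\<^sup>2 < \<gamma> / (2 * (1 - \<gamma> * norm (x0 - xstar))\<^sup>2 - 1))) \<and>
            (\<exists>x. newton_sequence \<Omega> F T x0 x \<and> (\<forall>k. \<exists>!y. newton_step F T (x k) y) \<and>
               (\<forall>k. x k \<in> eball xstar r) \<and> x \<longlonglongrightarrow> xstar \<and>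
               (\<forall>k. norm (x (Suc k) - xstar)
                      \<le> \<gamma> / (2 * (1 - \<gamma> * t k)\<^sup>2 - 1) * (norm (x k - xstar))\<^sup>2 \<and>
                    \<gamma> / (2 * (1 - \<gamma> * t k)\<^sup>2 - 1) * (norm (x k - xstar))\<^sup>2
                      \<le> \<gamma> / (2 * (1 - \<gamma> * norm (x0 - xstar))\<^sup>2 - 1) * (norm (x k - xstar))\<^sup>2))) \<and>
         (\<forall>x \<in> eball xstar \<sigma>. 0 \<in> F x +o T x \<longleftrightarrow> x = xstar) \<and>
         (\<rho> < \<kappa> \<longrightarrow> r = \<rho> \<and> best_convergence_radius TYPE('a) \<gamma> r)"
proof (intro conjI)
  have problem: "newton_problem \<Omega> F T xstar \<gamma>" using assms unfolding newton_problem_def by blast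
  \<comment> \<open>A point at distance below the supremum already lies in one of the balls over
    which it is taken.\<close>
  have "eball xstar \<kappa> \<subseteq> \<Omega>"
  proof
    fix x assume "x \<in> eball xstar \<kappa>"
    then obtain t where "ball xstar t \<subseteq> \<Omega>" "ereal (dist xstar x) < ereal t"
      unfolding assms(10) by (auto simp: less_SUP_iff)
    then show "x \<in> \<Omega>" by auto
  qed
  then have sub: "eball xstar r \<subseteq> \<Omega>" unfolding assms(12) by auto
  have r: "r \<le> ereal (5 - sqrt 17) / ereal (4 * \<gamma>)" unfolding assms(12,11) by simp
  show "\<forall>x \<in> eball xstar \<sigma>. 0 \<in> F x +o T x \<longleftrightarrow> x = xstar"
    using newton_solution_unique[OF problem sub] assms(6) unfolding assms(13) by blast
  show "\<rho> < \<kappa> \<longrightarrow> r = \<rho> \<and> best_convergence_radius TYPE('a) \<gamma> r"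
  proof (intro impI conjI)
    assume "\<rho> < \<kappa>"
    then show r_eq: "r = \<rho>" unfolding assms(12) by simp
    \<comment> \<open>Since \<open>\<rho> < \<kappa>\<close> makes \<open>\<rho>\<close> finite,
      \<open>\<gamma>\<close> is nonzero, and so is the space; this supplies the unit vector for the
      counterexamples.\<close>
    have g0: "\<gamma> \<noteq> 0"
    proof
      assume "\<gamma> = 0"
      then have "\<rho> = \<infinity>" using radius_constant_bounds(1) unfolding assms(11) by simp
      then show False using \<open>\<rho> < \<kappa>\<close> by simp
    qed
    then have nontrivial: "\<exists>v::'a. v \<noteq> 0" using newton_gamma_trivial[of F xstar] assms(9) by auto
    have "newton_setting \<Omega> F T xstar \<gamma> 0" by unfold_locales (use problem nontrivial in auto)
    then have g: "0 < \<gamma>" using newton_setting.gamma_nonneg g0 by force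
    obtain v :: 'a where "v \<noteq> 0" using nontrivial by blast
    then have e: "norm (v /\<^sub>R norm v) = 1" by simp
    have rho: "\<rho> = ereal ((5 - sqrt 17) / (4 * \<gamma>))" unfolding assms(11) using g by simp
    show "best_convergence_radius TYPE('a) \<gamma> r"
      unfolding best_convergence_radius_def
    proof (intro conjI allI impI)
      show "convergence_radius TYPE('a) \<gamma> r"
        unfolding r_eq assms(11) by (rule convergence_radius_constant)
      show "\<not> convergence_radius TYPE('a) \<gamma> R" if "r < R" for R
        using not_convergence_radius_above[OF e g] that unfolding r_eq rho by blast
    qed
  qed
  show "\<forall>x0 \<in> eball xstar r - {xstar}. \<forall>t. t = scalar_sequence \<gamma> (norm (xstar - x0)) \<longrightarrow>
            (\<forall>k. 2 * (1 - \<gamma> * t k)\<^sup>2 - 1 \<noteq> 0) \<and>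
            (\<forall>k. 0 \<le> t k \<and> ereal (t k) < r) \<and> t \<longlonglongrightarrow> 0 \<and>
            (\<gamma> \<noteq> 0 \<longrightarrow>
               (\<forall>k. t (Suc k) < t k) \<and> (\<forall>k. 0 < t k) \<and>
               (\<forall>k. t (Suc (Suc k)) / (t (Suc k))\<^sup>2 < t (Suc k) / (t k)\<^sup>2) \<and>
               (\<forall>k. t (Suc k) / (t k)\<^sup>2 \<le> \<gamma> / (2 * (1 - \<gamma> * norm (x0 - xstar))\<^sup>2 - 1)) \<and>
               (\<forall>k>0. t (Suc k) / (t k)\<^sup>2 < \<gamma> / (2 * (1 - \<gamma> * norm (x0 - xstar))\<^sup>2 - 1))) \<and>
            (\<exists>x. newton_sequence \<Omega> F T x0 x \<and> (\<forall>k. \<exists>!y. newton_step F T (x k) y) \<and>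
               (\<forall>k. x k \<in> eball xstar r) \<and> x \<longlonglongrightarrow> xstar \<and>
               (\<forall>k. norm (x (Suc k) - xstar)
                      \<le> \<gamma> / (2 * (1 - \<gamma> * t k)\<^sup>2 - 1) * (norm (x k - xstar))\<^sup>2 \<and>
                    \<gamma> / (2 * (1 - \<gamma> * t k)\<^sup>2 - 1) * (norm (x k - xstar))\<^sup>2
                      \<le> \<gamma> / (2 * (1 - \<gamma> * norm (x0 - xstar))\<^sup>2 - 1) * (norm (x k - xstar))\<^sup>2))"
  proof (intro ballI allI impI)
    fix x0 t' assume x0: "x0 \<in> eball xstar r - {xstar}" and t': "t' = scalar_sequence \<gamma> (norm (xstar - x0))"
    have x0': "x0 \<in> eball xstar r" "x0 \<noteq> xstar" using x0 by auto
    have n0: "ereal (norm (x0 - xstar)) < r" "0 < norm (x0 - xstar)"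
      using x0' by (auto simp: dist_norm norm_minus_commute)
    note conv = newton_convergence[OF problem sub r x0']
    interpret newton_majorant \<gamma> "norm (x0 - xstar)" by (rule conv(1))
    have t: "t' = t" unfolding t' by (simp add: norm_minus_commute)
    have den: "2 * (1 - \<gamma> * t k)\<^sup>2 - 1 \<noteq> 0" for k
      using denominator_pos[OF t_nonneg t_le] by (metis less_irrefl)
    have lt_r: "ereal (t k) < r" for k
      using t_le[of k] n0(1) by (meson ereal_less_eq(3) le_less_trans)
    obtain x where x: "newton_sequence \<Omega> F T x0 x" "\<forall>k. \<exists>!y. newton_step F T (x k) y"
        "\<forall>k. x k \<in> eball xstar r" "x \<longlonglongrightarrow> xstar"
        "\<And>k. norm (x (Suc k) - xstar) \<le> factor (t k) * (norm (x k - xstar))\<^sup>2"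
      using conv(2) unfolding factor_def by blast
    have est: "factor (t k) * (norm (x k - xstar))\<^sup>2 \<le> factor (norm (x0 - xstar)) * (norm (x k - xstar))\<^sup>2" for k
      by (intro mult_right_mono factor_mono t_nonneg t_le) auto
    have strict: "(\<forall>k. t (Suc k) < t k) \<and> (\<forall>k. 0 < t k) \<and>
        (\<forall>k. t (Suc (Suc k)) / (t (Suc k))\<^sup>2 < t (Suc k) / (t k)\<^sup>2) \<and>
        (\<forall>k. t (Suc k) / (t k)\<^sup>2 \<le> factor (norm (x0 - xstar))) \<and>
        (\<forall>k>0. t (Suc k) / (t k)\<^sup>2 < factor (norm (x0 - xstar)))" if "\<gamma> \<noteq> 0"
    proof (intro conjI allI impI)
      have g: "0 < \<gamma>" using that gamma_nonneg by simp
      fix k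
      show "t (Suc k) < t k" "0 < t k" "t (Suc (Suc k)) / (t (Suc k))\<^sup>2 < t (Suc k) / (t k)\<^sup>2"
        using t_strict_decreasing t_pos t_quotient_decreasing g n0(2) by blast+
      show "t (Suc k) / (t k)\<^sup>2 \<le> factor (norm (x0 - xstar))"
        unfolding t_quotient[OF g n0(2)] by (intro factor_mono t_nonneg t_le order_refl)
      show "t (Suc k) / (t k)\<^sup>2 < factor (norm (x0 - xstar))" if "0 < k"
        unfolding t_quotient[OF g n0(2)]
        by (intro factor_strict_mono g t_nonneg t_less_t0 n0(2) that order_refl)
    qed
    show "(\<forall>k. 2 * (1 - \<gamma> * t' k)\<^sup>2 - 1 \<noteq> 0) \<and>
            (\<forall>k. 0 \<le> t' k \<and> ereal (t' k) < r) \<and> t' \<longlonglongrightarrow> 0 \<and>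
            (\<gamma> \<noteq> 0 \<longrightarrow>
               (\<forall>k. t' (Suc k) < t' k) \<and> (\<forall>k. 0 < t' k) \<and>
               (\<forall>k. t' (Suc (Suc k)) / (t' (Suc k))\<^sup>2 < t' (Suc k) / (t' k)\<^sup>2) \<and>
               (\<forall>k. t' (Suc k) / (t' k)\<^sup>2 \<le> \<gamma> / (2 * (1 - \<gamma> * norm (x0 - xstar))\<^sup>2 - 1)) \<and>
               (\<forall>k>0. t' (Suc k) / (t' k)\<^sup>2 < \<gamma> / (2 * (1 - \<gamma> * norm (x0 - xstar))\<^sup>2 - 1))) \<and>
            (\<exists>x. newton_sequence \<Omega> F T x0 x \<and> (\<forall>k. \<exists>!y. newton_step F T (x k) y) \<and>
               (\<forall>k. x k \<in> eball xstar r) \<and> x \<longlonglongrightarrow> xstar \<and>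
               (\<forall>k. norm (x (Suc k) - xstar)
                      \<le> \<gamma> / (2 * (1 - \<gamma> * t' k)\<^sup>2 - 1) * (norm (x k - xstar))\<^sup>2 \<and>
                    \<gamma> / (2 * (1 - \<gamma> * t' k)\<^sup>2 - 1) * (norm (x k - xstar))\<^sup>2
                      \<le> \<gamma> / (2 * (1 - \<gamma> * norm (x0 - xstar))\<^sup>2 - 1) * (norm (x k - xstar))\<^sup>2))"
      unfolding t factor_def[symmetric]
    proof (intro conjI exI[of _ x])
      show "\<gamma> \<noteq> 0 \<longrightarrow> (\<forall>k. t (Suc k) < t k) \<and> (\<forall>k. 0 < t k) \<and>
        (\<forall>k. t (Suc (Suc k)) / (t (Suc k))\<^sup>2 < t (Suc k) / (t k)\<^sup>2) \<and>
        (\<forall>k. t (Suc k) / (t k)\<^sup>2 \<le> factor (norm (x0 - xstar))) \<and>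
        (\<forall>k>0. t (Suc k) / (t k)\<^sup>2 < factor (norm (x0 - xstar)))"
        using strict by (rule impI)
      show "\<forall>k. norm (x (Suc k) - xstar) \<le> factor (t k) * (norm (x k - xstar))\<^sup>2 \<and>
          factor (t k) * (norm (x k - xstar))\<^sup>2 \<le> factor (norm (x0 - xstar)) * (norm (x k - xstar))\<^sup>2"
        using x(5) est by (intro allI conjI)
    qed (use den t_nonneg lt_r t_tendsto_0 x(1-4) in \<open>simp_all only:, simp_all\<close>)
  qed
qed

end
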